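(* Let $N,Q\in\mathbb{N}$ with $Q\le N$, let $f:\mathbb{N}\to\mathbb{C}$ be any arithmetic function, and let $g_Q:\mathbb{N}\to\mathbb{C}$ be an arithmetic function whose Eratosthenes Transform $g_Q'$ vanishes outside $[1,Q]$, i.e. $g_Q(m)=\sum_{d\mid m,\ d\le Q} g_Q'(d)$ for all $m$. For fixed $N$, consider the correlation as a function of the shift $a\in\mathbb{N}$: $$C_{f,g_Q}(N,a)=\sum_{n\le N} f(n)\,g_Q(n+a).$$ Then: (A) $a\mapsto C_{f,g_Q}(N,a)$ is periodic on $\mathbb{N}$, hence bounded; (B) for every $\ell\in\mathbb{N}$ the Carmichael coefficient $\mathrm{Car}_\ell C_{f,g_Q}(N,\bullet)$ and the Wintner coefficient $\mathrm{Win}_\ell C_{f,g_Q}(N,\bullet)$ exist and coincide, and they vanish for all $\ell>Q$; (C) for every $\ell\in\mathbb{N}$, $$\mathrm{Win}_\ell C_{f,g_Q}(N,\bullet)=\mathrm{Car}_\ell C_{f,g_Q}(N,\bullet)=\frac{\widehat{g_Q}(\ell)}{\varphi(\ell)}\sum_{n\le N} f(n)\,c_\ell(n),$$ where $\widehat{g_Q}(\ell)=\sum_{d\le Q,\ d\equiv 0\ (\mathrm{mod}\ \ell)} \frac{g_Q'(d)}{d}$.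
   Context: For $h:\mathbb{N}\to\mathbb{C}$, the Eratosthenes Transform is $h'(d)=\sum_{t\mid d}h(t)\mu(d/t)$ ($\mu$ the Möbius function). $\varphi$ is Euler's totient. The Ramanujan sum is $c_q(m)=\sum_{1\le j\le q,\ (j,q)=1} e^{2\pi i jm/q}$. For $F:\mathbb{N}\to\mathbb{C}$ and $q\in\mathbb{N}$: the $q$-th Carmichael coefficient is $\mathrm{Car}_q F=\frac{1}{\varphi(q)}\lim_{x\to\infty}\frac1x\sum_{a\le x}F(a)c_q(a)$, when the limit exists in $\mathbb{C}$; the $q$-th Wintner coefficient is $\mathrm{Win}_q F=\sum_{d\ge1,\ d\equiv 0\ (\mathrm{mod}\ q)} \frac{F'(d)}{d}$, when this series converges. Here $F(a)=C_{f,g_Q}(N,a)$ with $N$ fixed. *)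

theory Defs
  imports "HOL-Computational_Algebra.Squarefree" "HOL-Number_Theory.Number_Theory" "HOL-Analysis.Analysis"
begin

text \<open>
  Arithmetic functions are represented as functions on \<open>nat\<close> of which only the values at positive
  arguments are used.
\<close>

definition moebius :: "nat \<Rightarrow> int" where
  "moebius n = (if squarefree n then (-1) ^ card (prime_factors n) else 0)"

definition eratosthenes :: "(nat \<Rightarrow> complex) \<Rightarrow> nat \<Rightarrow> complex" where
  "eratosthenes h d = (\<Sum>t | t dvd d. h t * of_int (moebius (d div t)))"

definition ramanujan_sum :: "nat \<Rightarrow> nat \<Rightarrow> complex" where
  "ramanujan_sum q m =
     (\<Sum>j | j \<in> {1..q} \<and> coprime j q.
        exp (2 * of_real pi * \<i> * of_nat j * of_nat m / of_nat q))"

definition carmichael_mean :: "(nat \<Rightarrow> complex) \<Rightarrow> nat \<Rightarrow> real \<Rightarrow> complex" where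
  "carmichael_mean F q x =
     1 / of_real x * (\<Sum>a = 1..nat \<lfloor>x\<rfloor>. F a * ramanujan_sum q a)"

definition carmichael_exists :: "(nat \<Rightarrow> complex) \<Rightarrow> nat \<Rightarrow> bool" where
  "carmichael_exists F q \<longleftrightarrow> (\<exists>L. (carmichael_mean F q \<longlongrightarrow> L) at_top)"

text \<open>Only meaningful when \<^const>\<open>carmichael_exists\<close> holds.\<close>

definition carmichael :: "(nat \<Rightarrow> complex) \<Rightarrow> nat \<Rightarrow> complex" where
  "carmichael F q = 1 / of_nat (totient q) * Lim at_top (carmichael_mean F q)"

definition wintner_term :: "(nat \<Rightarrow> complex) \<Rightarrow> nat \<Rightarrow> nat \<Rightarrow> complex" where
  "wintner_term F q d = (if d \<ge> 1 \<and> q dvd d then eratosthenes F d / of_nat d else 0)"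

text \<open>
  Convergence of the Wintner series is convergence of its partial sums in increasing order of the
  summation index; absolute convergence is not required.
\<close>

definition wintner_exists :: "(nat \<Rightarrow> complex) \<Rightarrow> nat \<Rightarrow> bool" where
  "wintner_exists F q \<longleftrightarrow> summable (wintner_term F q)"

text \<open>Only meaningful when \<^const>\<open>wintner_exists\<close> holds.\<close>

definition wintner :: "(nat \<Rightarrow> complex) \<Rightarrow> nat \<Rightarrow> complex" where
  "wintner F q = (\<Sum>d. wintner_term F q d)"

definition correlation ::
    "(nat \<Rightarrow> complex) \<Rightarrow> (nat \<Rightarrow> complex) \<Rightarrow> nat \<Rightarrow> nat \<Rightarrow> complex" where
  "correlation f g N a = (\<Sum>n = 1..N. f n * g (n + a))"

definition g_hat :: "(nat \<Rightarrow> complex) \<Rightarrow> nat \<Rightarrow> nat \<Rightarrow> complex" where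
  "g_hat g Q l = (\<Sum>d | d \<in> {1..Q} \<and> l dvd d. eratosthenes g d / of_nat d)"

end

theory Submission
  imports Defs "HOL-Complex_Analysis.Complex_Analysis"
begin

text \<open>The correlation is a periodic function \<open>F\<close> of the shift. For periodic \<open>F\<close> the Wintner series
  converges only conditionally, at the depth of the prime number theorem: averaging over the classes
  \<open>gcd t q = h\<close> reduces the claim to functions with mean zero on each class, whose partial Wintner
  sums are \<open>\<Sum>\<^bsub>te \<le> x, q | te\<^esub> F(t) \<mu>(e) / (te)\<close>. By the hyperbola method these tend to zero because
  \<open>\<Sum>\<^bsub>k | e\<^esub> \<mu>(e) / e = 0\<close> for every \<open>k\<close>, which follows from the non-vanishing of \<open>\<zeta>\<close> on
  \<open>Re s = 1\<close> by Newman's contour argument. So Wintner and Carmichael coefficients agree for all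
  periodic functions, and the latter are finite means, computed with roots of unity.\<close>

section \<open>The Moebius function\<close>

text \<open>The obstacle is the shift. Although \<open>g\<close> has a finitely supported transform,
  \<open>g (n + a)\<close> as a function of \<open>a\<close> usually has not: the indicator of the
  class of 1 modulo 3 has transform -1 at every prime congruent to 2 modulo 3, so its Wintner series
  is infinite and does not converge absolutely. No rearrangement can settle it, and cancellation in
  the Moebius function is indispensable. The classes \<open>gcd t q = h\<close> are the right ones
  because \<open>q dvd t * e\<close> means that \<open>q div gcd t q\<close> divides
  \<open>e\<close>: on a class the constraint falls on the Moebius variable alone, and a Dirichlet
  convolution of two independent factors remains. This is also where the restriction to multiples
  \<open>k dvd e\<close> comes from. The other factor has mean zero over a period, hence bounded
  partial sums, and against such a factor the bare limit \<open>0\<close> for the Moebius sums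
  suffices, without any rate. Ramanujan sums are constant on the same classes, so the mean-zero part
  is invisible to the Carmichael coefficient as well.\<close>

lemma squarefree_prod_primes:
  fixes A :: "nat set"
  assumes "finite A" "\<And>p. p \<in> A \<Longrightarrow> prime p"
  shows "squarefree (\<Prod>A)" "prime_factors (\<Prod>A) = A"
proof -
  show "squarefree (\<Prod>A)"
    using squarefree_prod_coprime[of A "\<lambda>x. x"] assms
    by (simp add: primes_coprime squarefree_prime)
  have "prime_factorization (\<Prod>A) = mset_set A"
    using prime_factorization_prod_mset_primes[of "mset_set A"] assms
    by (simp add: prod_unfold_prod_mset)
  then show "prime_factors (\<Prod>A) = A"
    using assms by simp
qed

lemma squarefree_eq_prod_prime_factors:
  fixes n :: nat
  assumes "squarefree n"
  shows "\<Prod>(prime_factors n) = n"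
proof -
  have n: "n \<noteq> 0" using assms by (metis not_squarefree_0)
  have "(\<Prod>p\<in>prime_factors n. p ^ multiplicity p n) = n"
    using prime_factorization_nat n by simp
  moreover have "multiplicity p n = 1" if "p \<in> prime_factors n" for p
    using squarefree_factorial_semiring'[OF n] assms that by auto
  ultimately show ?thesis by simp
qed

lemma moebius_prod_primes:
  assumes "finite A" "\<And>p. p \<in> A \<Longrightarrow> prime p"
  shows "moebius (\<Prod>A) = (-1) ^ card A"
  using squarefree_prod_primes[OF assms] by (simp add: moebius_def)

lemma abs_moebius_le: "\<bar>moebius n\<bar> \<le> 1"
  by (auto simp: moebius_def power_abs)

lemma norm_moebius_le: "norm (of_int (moebius n) :: complex) \<le> 1"
  using abs_moebius_le[of n] by (metis norm_of_int of_int_abs of_int_le_1_iff)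

lemma moebius_prime_mult:
  assumes "prime p" "\<not> p dvd n"
  shows "moebius (p * n) = - moebius n"
proof (cases "squarefree n")
  case True
  then have n: "n \<noteq> 0" by (metis not_squarefree_0)
  have cop: "coprime p n" using assms by (simp add: prime_imp_coprime)
  have "squarefree (p * n)" using cop True assms by (simp add: squarefree_mult_coprime squarefree_prime)
  moreover have "prime_factors (p * n) = insert p (prime_factors n)"
    using n assms by (auto simp: prime_factors_product prime_prime_factors)
  moreover have "p \<notin> prime_factors n" using assms by auto
  ultimately show ?thesis using True by (simp add: moebius_def)
next
  case False
  then have "\<not> squarefree (p * n)" using squarefree_multD(2) by blast
  then show ?thesis using False by (simp add: moebius_def)
qed

lemma moebius_prime_square_dvd:
  assumes "prime p" "p dvd n"
  shows "moebius (p * n) = 0"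
proof -
  have "p ^ 2 dvd p * n" using assms by (simp add: power2_eq_square)
  then have "\<not> squarefree (p * n)" using assms not_squarefreeI by (metis not_prime_unit)
  then show ?thesis by (simp add: moebius_def)
qed

text \<open>Expanding the product gives one term per subset of \<open>A\<close>, and unique
  factorization identifies subsets with squarefree numbers. It is used with \<open>f = 1\<close> for
  the divisor sum of the Moebius function and with \<open>n powr - s\<close> for the Euler
  product.\<close>

lemma prod_one_minus_primes:
  fixes f :: "nat \<Rightarrow> complex"
  assumes "finite A" "\<And>p. p \<in> A \<Longrightarrow> prime p"
    and mult: "\<And>S. S \<subseteq> A \<Longrightarrow> f (\<Prod>S) = (\<Prod>p\<in>S. f p)"
  shows "(\<Prod>p\<in>A. 1 - f p) = (\<Sum>n | squarefree n \<and> prime_factors n \<subseteq> A. of_int (moebius n) * f n)"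
proof -
  have "(\<Prod>p\<in>A. 1 - f p) = (\<Prod>p\<in>A. - f p + 1)" by simp
  also have "\<dots> = (\<Sum>S\<in>Pow A. (\<Prod>p\<in>S. - f p) * (\<Prod>p\<in>A-S. 1))"
    using assms(1) by (rule prod_add)
  also have "\<dots> = (\<Sum>S\<in>Pow A. of_int (moebius (\<Prod>S)) * f (\<Prod>S))"
  proof (rule sum.cong)
    fix S assume S: "S \<in> Pow A"
    then have "finite S" using assms(1) finite_subset by auto
    have "moebius (\<Prod>S) = (-1) ^ card S"
      using S assms \<open>finite S\<close> by (intro moebius_prod_primes) auto
    then show "(\<Prod>p\<in>S. - f p) * (\<Prod>p\<in>A-S. 1) = of_int (moebius (\<Prod>S)) * f (\<Prod>S)"
      using S mult by (simp add: prod_uminus)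
  qed simp
  also have "\<dots> = (\<Sum>n | squarefree n \<and> prime_factors n \<subseteq> A. of_int (moebius n) * f n)"
  proof (rule sum.reindex_bij_witness[where i = prime_factors and j = "\<lambda>S. \<Prod>S"])
    fix S assume S: "S \<in> Pow A"
    then have fin: "finite S" and pr: "\<And>p. p \<in> S \<Longrightarrow> prime p" using assms finite_subset by auto
    show "prime_factors (\<Prod>S) = S" using squarefree_prod_primes[OF fin pr] by simp
    then show "\<Prod>S \<in> {n. squarefree n \<and> prime_factors n \<subseteq> A}"
      using squarefree_prod_primes(1)[OF fin pr] S by auto
  qed (auto simp: squarefree_eq_prod_prime_factors)
  finally show ?thesis .
qed

text \<open>Only squarefree divisors contribute. Their sum is the expanded product of
  \<open>1 - 1\<close> over the primes of \<open>n\<close>, which is empty exactly for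
  \<open>n = 1\<close>.\<close>

lemma sum_moebius_divisors:
  assumes "n > 0"
  shows "(\<Sum>d | d dvd n. of_int (moebius d)) = (if n = 1 then 1 else 0 :: complex)"
proof -
  have fin: "finite {d. d dvd n}" using assms by simp
  have "(\<Sum>d | d dvd n. of_int (moebius d) :: complex)
      = (\<Sum>d | squarefree d \<and> prime_factors d \<subseteq> prime_factors n. of_int (moebius d) * 1)"
  proof (rule sum.mono_neutral_cong_right[OF fin])
    show "{d. squarefree d \<and> prime_factors d \<subseteq> prime_factors n} \<subseteq> {d. d dvd n}"
    proof safe
      fix d assume d: "squarefree d" "prime_factors d \<subseteq> prime_factors n"
      have "d = \<Prod>(prime_factors d)" using d(1) by (simp add: squarefree_eq_prod_prime_factors)
      also have "\<dots> dvd \<Prod>(prime_factors n)" using d(2) by (intro prod_dvd_prod_subset) auto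
      also have "\<dots> dvd n" 
      proof -
        have "\<Prod>(prime_factors n) dvd (\<Prod>p\<in>prime_factors n. p ^ multiplicity p n)"
          by (intro prod_dvd_prod dvd_power) (auto simp: prime_factors_multiplicity)
        then show ?thesis using assms by (simp add: prime_factorization_nat[symmetric])
      qed
      finally show "d dvd n" .
    qed
    show "\<forall>d\<in>{d. d dvd n} - {d. squarefree d \<and> prime_factors d \<subseteq> prime_factors n}.
       complex_of_int (moebius d) = 0"
      using assms dvd_prime_factors by (auto simp: moebius_def)
  qed auto
  also have "\<dots> = (\<Prod>p\<in>prime_factors n. 1 - 1)"
    by (rule prod_one_minus_primes[symmetric]) auto
  also have "\<dots> = (if n = 1 then 1 else 0)"
    using assms by (auto simp: card_gt_0_iff prime_factorization_empty_iff)
  finally show ?thesis .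
qed

lemma eratosthenes_inversion:
  assumes "n > 0"
  shows "h n = (\<Sum>d | d dvd n. eratosthenes h d)"
proof -
  have fin: "finite {d. d dvd n}" using assms by simp
  have "(\<Sum>d | d dvd n. eratosthenes h d)
      = (\<Sum>d | d dvd n. \<Sum>t | t dvd n \<and> t dvd d. h t * of_int (moebius (d div t)))"
    unfolding eratosthenes_def by (intro sum.cong) (auto intro: dvd_trans)
  also have "\<dots> = (\<Sum>t | t dvd n. \<Sum>d | d dvd n \<and> t dvd d. h t * of_int (moebius (d div t)))"
    using sum.swap_restrict[OF fin fin, of "\<lambda>d t. h t * of_int (moebius (d div t))" "\<lambda>d t. t dvd d"]
    by simp
  also have "\<dots> = (\<Sum>t | t dvd n. h t * (if t = n then 1 else 0))"
  proof (intro sum.cong refl)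
    fix t assume t: "t \<in> {t. t dvd n}"
    then obtain k where k: "n = t * k" by auto
    then have pos: "t > 0" "k > 0" using assms by auto
    have "(\<Sum>d | d dvd n \<and> t dvd d. h t * of_int (moebius (d div t)))
        = (\<Sum>e | e dvd k. h t * of_int (moebius e))"
      by (rule sum.reindex_bij_witness[where i = "\<lambda>e. t * e" and j = "\<lambda>d. d div t"])
         (use k pos in auto)
    also have "\<dots> = h t * (if k = 1 then 1 else 0)"
      using sum_moebius_divisors[OF pos(2)] by (simp add: sum_distrib_left[symmetric])
    also have "(k = 1) = (t = n)" using k pos by auto
    finally show "(\<Sum>d | d dvd n \<and> t dvd d. h t * of_int (moebius (d div t)))
      = h t * (if t = n then 1 else 0)" .
  qed
  also have "\<dots> = (\<Sum>t\<in>{t. t dvd n}. if t = n then h t else 0)"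
    by (intro sum.cong) auto
  also have "\<dots> = h n" using fin by (simp add: sum.delta)
  finally show ?thesis by simp
qed

section \<open>The regularized zeta function\<close>

lemma norm_nat_powr: "norm (of_nat n powr s :: complex) = real n powr Re s"
  by (metis norm_powr_real_powr of_nat_0_le_iff of_real_of_nat_eq Re_complex_of_real Reals_of_nat)

lemma summable_nat_powr:
  assumes "Re s > 1"
  shows "summable (\<lambda>n. norm (of_nat n powr - s :: complex))"
  using assms by (simp add: norm_nat_powr summable_real_powr_iff)

lemma summable_bounded_dirichlet:
  fixes a :: "nat \<Rightarrow> complex"
  assumes "Re s > 1" "\<And>n. norm (a n) \<le> 1"
  shows "summable (\<lambda>n. norm (a n * of_nat n powr - s))"
proof (rule summable_comparison_test'[OF summable_nat_powr[OF assms(1)], of 0])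
  show "norm (norm (a n * of_nat n powr - s)) \<le> norm (of_nat n powr - s :: complex)" for n
    using mult_right_mono[OF assms(2)[of n], of "norm (of_nat n powr - s)"] by (simp add: norm_mult)
qed

text \<open>Summation may start at \<open>0\<close>, since \<open>0 powr - s\<close> is
  \<open>0\<close> by convention; the same holds for \<open>moebius_series\<close>.\<close>

definition zeta_series :: "complex \<Rightarrow> complex" where
  "zeta_series s = (\<Sum>n. of_nat n powr - s)"

definition moebius_series :: "complex \<Rightarrow> complex" where
  "moebius_series s = (\<Sum>n. of_int (moebius n) * of_nat n powr - s)"

text \<open>Absolute convergence allows the double series to be regrouped by the product
  \<open>k = m * n\<close>; the divisor sums of the Moebius function then leave only
  \<open>k = 1\<close>.\<close>

lemma moebius_series_mult_zeta_series:
  assumes s: "Re s > 1"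
  shows "moebius_series s * zeta_series s = 1"
proof -
  let ?A = "{1::nat..}"
  define a b where "a = (\<lambda>n. of_int (moebius n) * of_nat n powr - s :: complex)"
    and "b = (\<lambda>n. of_nat n powr - s :: complex)"
  have suma: "summable (\<lambda>n. norm (a n))" and sumb: "summable (\<lambda>n. norm (b n))"
    unfolding a_def b_def using summable_bounded_dirichlet[OF s norm_moebius_le] summable_nat_powr[OF s] by auto
  have ha: "infsum a ?A = moebius_series s" and hb: "infsum b ?A = zeta_series s"
    and aa: "(\<lambda>n. norm (a n)) summable_on ?A" and bb: "(\<lambda>n. norm (b n)) summable_on ?A"
  proof -
    have "(a has_sum suminf a) UNIV" "(b has_sum suminf b) UNIV"
      using norm_summable_imp_has_sum suma sumb summable_norm_cancel summable_sums by blast+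
    moreover have "(a has_sum suminf a) UNIV \<longleftrightarrow> (a has_sum suminf a) ?A"
      by (rule has_sum_cong_neutral) (auto simp: a_def not_le)
    moreover have "(b has_sum suminf b) UNIV \<longleftrightarrow> (b has_sum suminf b) ?A"
      by (rule has_sum_cong_neutral) (auto simp: b_def not_le)
    ultimately show "infsum a ?A = moebius_series s" "infsum b ?A = zeta_series s"
      unfolding moebius_series_def zeta_series_def using infsumI a_def b_def by auto
    have "(\<lambda>n. norm (a n)) summable_on UNIV" "(\<lambda>n. norm (b n)) summable_on UNIV"
      using norm_summable_imp_summable_on[of "\<lambda>n. norm (a n)"] norm_summable_imp_summable_on[of "\<lambda>n. norm (b n)"]
        suma sumb by simp_all
    then show "(\<lambda>n. norm (a n)) summable_on ?A" "(\<lambda>n. norm (b n)) summable_on ?A"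
      using summable_on_subset_banach subset_UNIV by blast+
  qed
  have "(\<lambda>p. norm ((\<lambda>(m,n). a m * b n) p)) summable_on ?A \<times> ?A"
    unfolding Infinite_Sum.abs_summable_on_Sigma_iff using aa bb
    by (auto simp: norm_mult abs_mult infsum_nonneg infsum_cmult_right' summable_on_cmult_right summable_on_cmult_left)
  then have summ: "(\<lambda>(m,n). a m * b n) summable_on ?A \<times> ?A"
    using abs_summable_summable by blast
  have bij: "bij_betw (\<lambda>(m,n). (m * n, m)) (?A \<times> ?A) (Sigma ?A (\<lambda>k. {d. d dvd k}))"
    by (rule bij_betw_byWitness[where f' = "\<lambda>(k,d). (d, k div d)"])
       (auto simp: Suc_le_eq elim!: dvdE)
  \<comment> \<open>In the coordinates (product, first factor) the power depends on \<open>k\<close>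
    alone, so the inner sum is a pure divisor sum.\<close>
  define g where "g = (\<lambda>(k, d). of_int (moebius d) * (of_nat k powr - s :: complex))"
  have eq: "(\<lambda>(m,n). a m * b n) = (\<lambda>p. g ((\<lambda>(m,n). (m * n, m)) p))"
    by (auto simp: g_def a_def b_def fun_eq_iff powr_times_real)
  have summ': "g summable_on (Sigma ?A (\<lambda>k. {d. d dvd k}))"
    using summ unfolding eq summable_on_reindex_bij_betw[OF bij] .
  have "moebius_series s * zeta_series s = infsum (\<lambda>m. infsum (\<lambda>n. a m * b n) ?A) ?A"
    unfolding ha[symmetric] hb[symmetric]
    by (simp add: infsum_cmult_right' infsum_cmult_left')
  also have "\<dots> = infsum (\<lambda>(m,n). a m * b n) (?A \<times> ?A)"
    using infsum_Sigma'_banach[OF summ] .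
  also have "\<dots> = infsum g (Sigma ?A (\<lambda>k. {d. d dvd k}))"
    unfolding eq by (rule infsum_reindex_bij_betw[OF bij])
  also have "\<dots> = infsum (\<lambda>k. infsum (\<lambda>d. g (k, d)) {d. d dvd k}) ?A"
    using infsum_Sigma_banach[OF summ'] by simp
  also have "\<dots> = infsum (\<lambda>k. if k = 1 then 1 else 0) ?A"
  proof (rule infsum_cong)
    fix k :: nat assume "k \<in> ?A"
    then have k: "k > 0" by simp
    then have "infsum (\<lambda>d. g (k, d)) {d. d dvd k} = (\<Sum>d | d dvd k. of_int (moebius d)) * of_nat k powr - s"
      by (simp add: g_def sum_distrib_right)
    then show "infsum (\<lambda>d. g (k, d)) {d. d dvd k} = (if k = 1 then 1 else 0)"
      using sum_moebius_divisors[OF k] by simp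
  qed
  also have "\<dots> = infsum (\<lambda>k. 1) {1::nat}"
    by (rule infsum_cong_neutral) auto
  finally show ?thesis by simp
qed

text \<open>Each term is, up to the factor \<open>s - 1\<close>, the error of replacing a summand of the zeta
  series by an integral; their sum continues \<open>(s - 1) \<zeta>(s)\<close> to \<open>Re s > 0\<close>.\<close>

definition zeta_term :: "nat \<Rightarrow> complex \<Rightarrow> complex" where
  "zeta_term n s = (s - 1) * of_nat (Suc n) powr - s - of_nat (Suc n) powr (1 - s)
     + of_nat (Suc (Suc n)) powr (1 - s)"

definition zeta_reg :: "complex \<Rightarrow> complex" where
  "zeta_reg s = 1 + (\<Sum>n. zeta_term n s)"

text \<open>Two mean value estimates in a row, on the segment from \<open>m\<close> to
  \<open>m + 1\<close>: the first bounds the variation of \<open>w powr - s\<close>, the second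
  integrates it. The gain of a factor \<open>1 / m\<close> over the size of a single summand gives
  convergence down to \<open>Re s > 0\<close>.\<close>

lemma norm_zeta_term_le:
  assumes s: "Re s > 0"
  shows "norm (zeta_term n s) \<le> norm (s - 1) * norm s * real (Suc n) powr (- Re s - 1)"
proof -
  define m where "m = real (Suc n)"
  have m: "m > 0" by (simp add: m_def)
  define S where "S = complex_of_real ` {m..m+1}"
  have conv: "convex S" unfolding S_def
    by (intro convex_linear_image bounded_linear.linear bounded_linear_of_real) auto
  have mS: "of_real m \<in> S" "of_real (m+1) \<in> S" unfolding S_def by (intro imageI; simp)+
  have dist: "norm (z - of_real m) \<le> 1" if "z \<in> S" for z
    using that by (auto simp: S_def simp flip: of_real_diff)
  have nz: "z \<noteq> 0" "z \<notin> \<real>\<^sub>\<le>\<^sub>0" if "z \<in> S" for z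
    using that m by (auto simp: S_def complex_nonpos_Reals_iff)
  have inner: "norm (z powr - s - of_real m powr - s) \<le> norm s * m powr (- Re s - 1)"
    if z: "z \<in> S" for z
  proof -
    have "norm (z powr - s - of_real m powr - s) \<le> (norm s * m powr (- Re s - 1)) * norm (z - of_real m)"
    proof (rule field_differentiable_bound[OF conv _ _ z mS(1)])
      fix w assume w: "w \<in> S"
      show "((\<lambda>w. w powr - s) has_field_derivative (- s * w powr (- s - 1))) (at w within S)"
        using nz[OF w] by (auto intro!: derivative_eq_intros has_field_derivative_powr simp: powr_diff)
      obtain x where x: "w = of_real x" "x \<ge> m" using w by (auto simp: S_def)
      have "norm (w powr (- s - 1)) = x powr (- Re s - 1)"
        using x m by (simp add: norm_powr_real_powr)
      also have "\<dots> \<le> m powr (- Re s - 1)" using x m s by (intro powr_mono2') auto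
      finally show "norm (- s * w powr (- s - 1)) \<le> norm s * m powr (- Re s - 1)"
        by (simp add: norm_mult mult_left_mono)
    qed
    also have "\<dots> \<le> (norm s * m powr (- Re s - 1)) * 1"
      using dist[OF z] by (intro mult_left_mono) auto
    finally show ?thesis by simp
  qed
  \<comment> \<open>The linear term makes the derivative vanish at \<open>m\<close>, so that the
    derivative is a difference already bounded by \<open>inner\<close>; the increment of
    \<open>\<phi>\<close> over the segment is exactly \<open>zeta_term n s\<close>.\<close>
  define \<phi> where "\<phi> z = z powr (1 - s) - (1 - s) * of_real m powr - s * z" for z
  have "norm (\<phi> (of_real (m+1)) - \<phi> (of_real m))
      \<le> (norm (s - 1) * (norm s * m powr (- Re s - 1))) * norm (of_real (m+1) - of_real m :: complex)"
  proof (rule field_differentiable_bound[OF conv _ _ mS(2) mS(1)])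
    fix w assume w: "w \<in> S"
    show "(\<phi> has_field_derivative ((1 - s) * (w powr - s - of_real m powr - s))) (at w within S)"
      unfolding \<phi>_def using nz[OF w]
      by (auto intro!: derivative_eq_intros has_field_derivative_powr simp: algebra_simps)
    show "norm ((1 - s) * (w powr - s - of_real m powr - s)) \<le> norm (s - 1) * (norm s * m powr (- Re s - 1))"
      using inner[OF w] by (simp add: norm_mult norm_minus_commute mult_left_mono)
  qed
  also have "\<phi> (of_real (m+1)) - \<phi> (of_real m) = zeta_term n s"
    by (simp add: \<phi>_def zeta_term_def m_def algebra_simps)
  finally show ?thesis by (simp add: m_def mult_ac)
qed

lemma summable_zeta_bound: "\<sigma> > 0 \<Longrightarrow> summable (\<lambda>n. C * real (Suc n) powr (- \<sigma> - 1))"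
  by (intro summable_mult) (subst summable_Suc_iff, simp add: summable_real_powr_iff)

lemma holomorphic_zeta_reg: "zeta_reg holomorphic_on {s. Re s > 0}"
proof -
  have "(\<lambda>s. \<Sum>n. zeta_term n s) holomorphic_on {s. Re s > 0}"
  proof (rule holomorphic_uniform_sequence[where f = "\<lambda>N s. \<Sum>n<N. zeta_term n s"])
    show "open {s. Re s > 0}" by (rule open_halfspace_Re_gt)
    show "(\<lambda>s. \<Sum>n<N. zeta_term n s) holomorphic_on {s. Re s > 0}" for N
      unfolding zeta_term_def by (intro holomorphic_intros)
    fix x assume "x \<in> {s. Re s > 0}"
    then have x: "Re x > 0" by simp
    \<comment> \<open>Half the distance to the imaginary axis: then \<open>Re z \<ge> d\<close> on
      the whole disc, and one exponent \<open>- d - 1\<close> serves as a majorant there.\<close>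
    define d where "d = Re x / 2"
    have d: "d > 0" using x by (simp add: d_def)
    have Re: "Re z \<ge> d" if "z \<in> cball x d" for z
      using that abs_Re_le_cmod[of "x - z"] by (simp add: d_def dist_norm)
    have "uniform_limit (cball x d) (\<lambda>N s. \<Sum>n<N. zeta_term n s) (\<lambda>s. \<Sum>n. zeta_term n s) sequentially"
    proof (rule Weierstrass_m_test[OF _ summable_zeta_bound[OF d]])
      fix n z assume z: "z \<in> cball x d"
      have nz: "norm z \<le> norm x + d" using z norm_triangle_ineq2[of z x] by (simp add: dist_norm norm_minus_commute)
      then have nz1: "norm (z - 1) \<le> norm x + d + 1" using norm_triangle_ineq4[of z 1] by simp
      have "norm (zeta_term n z) \<le> norm (z - 1) * norm z * real (Suc n) powr (- Re z - 1)"
        using Re[OF z] d by (intro norm_zeta_term_le) auto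
      also have "\<dots> \<le> (norm x + d + 1) * (norm x + d) * real (Suc n) powr (- d - 1)"
        using nz nz1 Re[OF z] d by (intro mult_mono powr_mono) auto
      finally show "norm (zeta_term n z) \<le> (norm x + d + 1) * (norm x + d) * real (Suc n) powr (- d - 1)" .
    qed
    moreover have "cball x d \<subseteq> {s. Re s > 0}" using Re d by force
    ultimately show "\<exists>d. 0 < d \<and> cball x d \<subseteq> {s. Re s > 0} \<and>
        uniform_limit (cball x d) (\<lambda>N s. \<Sum>n<N. zeta_term n s) (\<lambda>s. \<Sum>n. zeta_term n s) sequentially"
      using d by blast
  qed
  then show ?thesis unfolding zeta_reg_def by (intro holomorphic_intros)
qed

lemma zeta_reg_1 [simp]: "zeta_reg 1 = 1"
  proof -
  have "zeta_term n 1 = 0" for n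
    unfolding zeta_term_def using of_nat_neq_0[of n] of_nat_neq_0[of "Suc n"] by (simp del: of_nat_Suc)
  then show ?thesis by (simp add: zeta_reg_def)
qed

lemma zeta_reg_eq:
  assumes s: "Re s > 1"
  shows "zeta_reg s = (s - 1) * zeta_series s"
proof -
  define u where "u n = (of_nat (Suc n) :: complex) powr (1 - s)" for n
  have "(\<lambda>n. real (Suc n) powr (1 - Re s)) \<longlonglongrightarrow> 0"
    by (rule tendsto_neg_powr[OF _ filterlim_compose[OF filterlim_real_sequentially filterlim_Suc]])
       (use s in simp)
  then have "(\<lambda>n. norm (u n)) \<longlonglongrightarrow> 0"
    unfolding u_def norm_nat_powr by simp
  then have "u \<longlonglongrightarrow> 0" by (simp add: tendsto_norm_zero_iff)
  \<comment> \<open>The telescoped total is \<open>- u 0 = - 1\<close>, which the leading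
    \<open>1\<close> of \<open>zeta_reg\<close> compensates.\<close>
  then have "(\<lambda>n. u (Suc n) - u n) sums (0 - u 0)" by (rule telescope_sums)
  moreover have "summable (\<lambda>n. of_nat n powr - s :: complex)"
    by (rule summable_norm_cancel[OF summable_nat_powr[OF s]])
  then have "(\<lambda>n. of_nat (Suc n) powr - s) sums zeta_series s"
    unfolding zeta_series_def by (subst sums_Suc_iff) (simp add: summable_sums)
  then have "(\<lambda>n. (s - 1) * of_nat (Suc n) powr - s) sums ((s - 1) * zeta_series s)"
    by (rule sums_mult)
  ultimately have "(\<lambda>n. (s - 1) * of_nat (Suc n) powr - s + (u (Suc n) - u n)) sums ((s - 1) * zeta_series s + (0 - u 0))"
    by (rule sums_add[rotated])
  also have "(\<lambda>n. (s - 1) * of_nat (Suc n) powr - s + (u (Suc n) - u n)) = (\<lambda>n. zeta_term n s)"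
    by (simp add: zeta_term_def u_def fun_eq_iff)
  finally show ?thesis
    by (simp add: sums_iff zeta_reg_def u_def)
qed

section \<open>Non-vanishing on the line Re s = 1\<close>

lemma nat_powr_prod: "(of_nat (\<Prod>S) :: complex) powr s = (\<Prod>p\<in>S. of_nat p powr s)"
proof (cases "finite S")
  case True
  then show ?thesis by (induction S) (auto simp: powr_times_real simp flip: of_nat_prod)
qed simp

text \<open>A finite product is the sum over the squarefree numbers with all primes up to
  \<open>P\<close>. These sets exhaust the support of the Moebius function, and an absolutely
  convergent series may be summed along any exhaustion.\<close>

lemma euler_product_moebius_series:
  assumes s: "Re s > 1"
  shows "(\<lambda>P. \<Prod>p | prime p \<and> p \<le> P. 1 - of_nat p powr - s) \<longlonglongrightarrow> moebius_series s"
proof -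
  define a where "a = (\<lambda>n. of_int (moebius n) * of_nat n powr - s :: complex)"
  define A where "A P = {p::nat. prime p \<and> p \<le> P}" for P
  define S where "S P = {n::nat. squarefree n \<and> prime_factors n \<subseteq> A P}" for P
  have finA: "finite (A P)" for P by (rule finite_subset[of _ "{..P}"]) (auto simp: A_def)
  have finS: "finite (S P)" for P
  proof (rule finite_subset)
    show "S P \<subseteq> (\<lambda>X. \<Prod>X) ` Pow (A P)"
    proof
      fix n assume "n \<in> S P"
      then have "n = \<Prod>(prime_factors n)" "prime_factors n \<in> Pow (A P)"
        by (auto simp: S_def squarefree_eq_prod_prime_factors)
      then show "n \<in> (\<lambda>X. \<Prod>X) ` Pow (A P)" by blast
    qed
  qed (use finA in auto)
  have suma: "summable (\<lambda>n. norm (a n))"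
    unfolding a_def by (rule summable_bounded_dirichlet[OF s norm_moebius_le])
  have "(a has_sum moebius_series s) UNIV"
    unfolding moebius_series_def a_def[symmetric]
    by (rule norm_summable_imp_has_sum[OF suma summable_sums[OF summable_norm_cancel[OF suma]]])
  then have "(sum a \<longlongrightarrow> moebius_series s) (finite_subsets_at_top UNIV)"
    by (simp add: has_sum_def)
  \<comment> \<open>\<open>S P\<close> omits the non-squarefree numbers and so never exhausts the
    naturals. Adjoining \<open>{..P}\<close> repairs this at no cost: a squarefree
    \<open>n \<le> P\<close> is already in \<open>S P\<close>, and the others have coefficient
    \<open>0\<close>.\<close>
  moreover have "filterlim (\<lambda>P. S P \<union> {..P}) (finite_subsets_at_top UNIV) sequentially"
    unfolding filterlim_finite_subsets_at_top
  proof safe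
    fix X :: "nat set" assume X: "finite X"
    have "\<forall>\<^sub>F P in sequentially. Max (insert 0 X) \<le> P" by (rule eventually_ge_at_top)
    then show "\<forall>\<^sub>F P in sequentially. finite (S P \<union> {..P}) \<and> X \<subseteq> S P \<union> {..P} \<and> S P \<union> {..P} \<subseteq> UNIV"
      by eventually_elim (use X finS in auto)
  qed
  ultimately have "(\<lambda>P. sum a (S P \<union> {..P})) \<longlonglongrightarrow> moebius_series s"
    by (rule filterlim_compose)
  moreover have "sum a (S P \<union> {..P}) = (\<Prod>p\<in>A P. 1 - of_nat p powr - s)" for P
  proof -
    have "sum a (S P \<union> {..P}) = sum a (S P)"
    proof (rule sum.mono_neutral_right)
      show "\<forall>n\<in>S P \<union> {..P} - S P. a n = 0"
      proof
        fix n assume n: "n \<in> S P \<union> {..P} - S P"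
        show "a n = 0"
        proof (cases "squarefree n")
          case True
          then have "n > 0" by (cases n) auto
          then have "prime_factors n \<subseteq> A P"
            using n by (auto simp: A_def in_prime_factors_iff dest!: dvd_imp_le)
          then show ?thesis using True n by (auto simp: S_def)
        qed (auto simp: a_def moebius_def)
      qed
    qed (use finS in auto)
    also have "\<dots> = (\<Prod>p\<in>A P. 1 - of_nat p powr - s)"
      unfolding S_def a_def
      by (rule prod_one_minus_primes[symmetric, OF finA])
         (simp_all add: A_def nat_powr_prod del: of_nat_prod)
    finally show ?thesis .
  qed
  ultimately show ?thesis by (simp add: A_def)
qed

text \<open>Taking logarithms, the n-th coefficient is a negative multiple of
  \<open>3 + 4 * Re u + Re (u\<^sup>2) = 2 * (1 + Re u)\<^sup>2\<close> with
  \<open>u = z ^ n\<close> on the unit circle. The inequality is stated for the factors of the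
  reciprocal of zeta, hence the upper bound \<open>1\<close>.\<close>

lemma three_four_one_factor:
  fixes r :: real and z :: complex
  assumes r: "0 \<le> r" "r < 1" and z: "norm z = 1"
  shows "norm (1 - of_real r :: complex) ^ 3 * norm (1 - of_real r * z) ^ 4 * norm (1 - of_real r * z\<^sup>2) \<le> 1"
proof -
  \<comment> \<open>The term at \<open>n = 0\<close> is a division by zero, hence \<open>0\<close>,
    so this is the logarithm series from \<open>n = 1\<close> on.\<close>
  have ser: "(\<lambda>n. - Re (w ^ n) / of_nat n) sums ln (norm (1 - w))" and pos: "norm (1 - w) > 0"
    if w: "norm w < 1" for w :: complex
  proof -
    have nz: "1 - w \<noteq> 0" using w by auto
    then show "norm (1 - w) > 0" by simp
    have "(\<lambda>n. (-1) ^ Suc n / of_nat n * (- w) ^ n) sums Ln (1 + (- w))"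
      using w by (intro Ln_series) simp
    moreover have "(\<lambda>n. (-1) ^ Suc n / of_nat n * (- w) ^ n) = (\<lambda>n. - (w ^ n) / of_nat n)"
      using power_mult_distrib[of "-1" "- w"] by (auto simp: fun_eq_iff)
    ultimately have "(\<lambda>n. - (w ^ n) / of_nat n) sums Ln (1 - w)"
      by (simp only: diff_conv_add_uminus)
    from sums_Re[OF this] show "(\<lambda>n. - Re (w ^ n) / of_nat n) sums ln (norm (1 - w))"
      using nz by (simp add: Re_Ln)
  qed
  define w1 w2 w3 :: complex where "w1 = of_real r" and "w2 = of_real r * z" and "w3 = of_real r * z\<^sup>2"
  have w: "norm w1 < 1" "norm w2 < 1" "norm w3 < 1"
    using r z by (auto simp: w1_def w2_def w3_def norm_mult norm_power)
  have "(\<lambda>n. 3 * (- Re (w1 ^ n) / of_nat n) + 4 * (- Re (w2 ^ n) / of_nat n) + - Re (w3 ^ n) / of_nat n)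
     sums (3 * ln (norm (1 - w1)) + 4 * ln (norm (1 - w2)) + ln (norm (1 - w3)))"
    by (intro sums_add sums_mult ser w)
  moreover have "\<And>n. 3 * (- Re (w1 ^ n) / of_nat n) + 4 * (- Re (w2 ^ n) / of_nat n) + - Re (w3 ^ n) / of_nat n \<le> 0"
  proof -
    fix n :: nat
    define u where "u = z ^ n"
    have "norm u = 1" using z by (simp add: u_def norm_power)
    then have "(Re u)\<^sup>2 + (Im u)\<^sup>2 = 1" by (metis cmod_power2 one_power2)
    then have "Re (u\<^sup>2) = 2 * (Re u)\<^sup>2 - 1" by (simp add: power2_eq_square)
    then have "3 + 4 * Re u + Re (u\<^sup>2) = 2 * (1 + Re u)\<^sup>2" by (simp add: power2_eq_square algebra_simps)
    then have nn: "3 + 4 * Re u + Re (u\<^sup>2) \<ge> 0" by simp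
    have "w1 ^ n = of_real (r ^ n)" "w2 ^ n = of_real (r ^ n) * u" "w3 ^ n = of_real (r ^ n) * u\<^sup>2"
      by (auto simp: w1_def w2_def w3_def u_def power_mult_distrib power_mult[symmetric] mult.commute)
    then have "3 * (- Re (w1 ^ n) / of_nat n) + 4 * (- Re (w2 ^ n) / of_nat n) + - Re (w3 ^ n) / of_nat n
       = - (r ^ n / of_nat n * (3 + 4 * Re u + Re (u\<^sup>2)))"
      by (simp add: field_simps add_divide_distrib)
    also have "\<dots> \<le> 0" using nn r by simp
    finally show "3 * (- Re (w1 ^ n) / of_nat n) + 4 * (- Re (w2 ^ n) / of_nat n) + - Re (w3 ^ n) / of_nat n \<le> 0" .
  qed
  ultimately have "3 * ln (norm (1 - w1)) + 4 * ln (norm (1 - w2)) + ln (norm (1 - w3)) \<le> 0"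
    by (rule sums_le[rotated, OF _ sums_zero])
  also have "3 * ln (norm (1 - w1)) + 4 * ln (norm (1 - w2)) + ln (norm (1 - w3))
     = ln (norm (1 - w1) ^ 3 * norm (1 - w2) ^ 4 * norm (1 - w3))"
    using pos w by (simp add: ln_mult ln_realpow)
  finally have "norm (1 - w1) ^ 3 * norm (1 - w2) ^ 4 * norm (1 - w3) \<le> 1"
    using pos w by (subst (asm) ln_le_zero_iff) auto
  then show ?thesis by (simp add: w1_def w2_def w3_def)
qed

lemma three_four_one_moebius_series:
  assumes "\<sigma> > 1"
  shows "norm (moebius_series (of_real \<sigma>)) ^ 3 * norm (moebius_series (of_real \<sigma> + \<i> * of_real t)) ^ 4
    * norm (moebius_series (of_real \<sigma> + 2 * \<i> * of_real t)) \<le> 1"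
proof -
  define E where "E s P = (\<Prod>p | prime p \<and> p \<le> P. 1 - of_nat p powr - s)" for s :: complex and P :: nat
  have lim: "E s \<longlonglongrightarrow> moebius_series s" if "Re s > 1" for s
    unfolding E_def using euler_product_moebius_series[OF that] .
  have "(\<lambda>P. norm (E (of_real \<sigma>) P) ^ 3 * norm (E (of_real \<sigma> + \<i> * of_real t) P) ^ 4
      * norm (E (of_real \<sigma> + 2 * \<i> * of_real t) P))
    \<longlonglongrightarrow> norm (moebius_series (of_real \<sigma>)) ^ 3 * norm (moebius_series (of_real \<sigma> + \<i> * of_real t)) ^ 4
    * norm (moebius_series (of_real \<sigma> + 2 * \<i> * of_real t))"
    using assms by (intro tendsto_intros lim) auto
  moreover have "norm (E (of_real \<sigma>) P) ^ 3 * norm (E (of_real \<sigma> + \<i> * of_real t) P) ^ 4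
      * norm (E (of_real \<sigma> + 2 * \<i> * of_real t) P) \<le> 1" for P
    unfolding E_def prod_norm[symmetric] prod_power_distrib prod.distrib[symmetric]
  proof (rule prod_le_1)
    fix p assume "p \<in> {p. prime p \<and> p \<le> P}"
    then have p: "p \<ge> 2" using prime_ge_2_nat by auto
    define r where "r = real p powr - \<sigma>"
    define z where "z = of_nat p powr (- \<i> * of_real t)"
    have "real p powr - \<sigma> < real p powr 0" using p assms by (intro powr_less_mono) auto
    then have r: "0 \<le> r" "r < 1" using p by (auto simp: r_def)
    have z: "norm z = 1" using p by (simp add: z_def norm_nat_powr)
    have p1: "of_nat p powr - complex_of_real \<sigma> = of_real r"
      using powr_of_real[of "real p" "- \<sigma>"] by (simp add: r_def)
    have p2: "of_nat p powr - (complex_of_real \<sigma> + \<i> * of_real t) = of_real r * z"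
      using p by (simp add: p1[symmetric] z_def powr_add[symmetric])
    have p3: "of_nat p powr - (complex_of_real \<sigma> + 2 * \<i> * of_real t) = of_real r * z\<^sup>2"
      using p by (simp add: p1[symmetric] z_def powr_add[symmetric] power2_eq_square mult_ac)
    show "0 \<le> norm (1 - of_nat p powr - complex_of_real \<sigma>) ^ 3 *
         norm (1 - of_nat p powr - (complex_of_real \<sigma> + \<i> * complex_of_real t)) ^ 4 *
         norm (1 - of_nat p powr - (complex_of_real \<sigma> + 2 * \<i> * complex_of_real t)) \<and>
         norm (1 - of_nat p powr - complex_of_real \<sigma>) ^ 3 *
         norm (1 - of_nat p powr - (complex_of_real \<sigma> + \<i> * complex_of_real t)) ^ 4 *
         norm (1 - of_nat p powr - (complex_of_real \<sigma> + 2 * \<i> * complex_of_real t)) \<le> 1"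
      unfolding p1 p2 p3 using three_four_one_factor[OF r z] by simp
  qed
  ultimately show ?thesis by (intro LIMSEQ_le_const2) auto
qed

lemma moebius_series_eq:
  assumes "Re s > 1"
  shows "zeta_reg s \<noteq> 0" "moebius_series s = (s - 1) / zeta_reg s"
proof -
  have "s \<noteq> 1" "moebius_series s \<noteq> 0" "zeta_series s \<noteq> 0"
    using moebius_series_mult_zeta_series[OF assms] assms by auto
  moreover have "(s - 1) / ((s - 1) * zeta_series s) = 1 / zeta_series s"
    using \<open>s \<noteq> 1\<close> by simp
  ultimately show "zeta_reg s \<noteq> 0" "moebius_series s = (s - 1) / zeta_reg s"
    using moebius_series_mult_zeta_series[OF assms] zeta_reg_eq[OF assms]
    by (simp_all add: eq_divide_eq)
qed

text \<open>On the open half plane the inverse series shows it, and at \<open>1\<close> the value is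
  \<open>1\<close>. Elsewhere on the line, a zero at \<open>s\<close> enters the 3-4-1 inequality
  with the fourth power, while the pole of zeta at \<open>1\<close> accounts only for the third;
  approaching from the right gives a contradiction.\<close>

lemma zeta_reg_nonzero:
  assumes "Re s \<ge> 1"
  shows "zeta_reg s \<noteq> 0"
proof -
  show ?thesis
  proof (cases "Re s > 1 \<or> s = 1")
    case True
    then show ?thesis using moebius_series_eq(1) by auto
  next
    case False
    define t where "t = Im s"
    have s: "s = 1 + \<i> * of_real t" and t: "t \<noteq> 0"
      using assms False by (auto simp: complex_eq_iff t_def)
    show ?thesis
    proof
      assume zero: "zeta_reg s = 0"
      have hol: "zeta_reg field_differentiable at u" if "Re u > 0" for u
        using holomorphic_zeta_reg that open_halfspace_Re_gt[of 0]
        by (auto intro: holomorphic_on_imp_differentiable_at)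
      have tr: "filterlim (\<lambda>x. u + of_real x) (nhds u) (at_right (0::real))" for u :: complex
        by (auto intro!: tendsto_eq_intros)
      have lim: "((\<lambda>x. zeta_reg (u + of_real x)) \<longlongrightarrow> zeta_reg u) (at_right 0)" if "Re u > 0" for u
        using isCont_tendsto_compose[OF _ tr] field_differentiable_imp_continuous_at[OF hol[OF that]] by blast
      have "((\<lambda>h. (zeta_reg (s + h) - zeta_reg s) / h) \<longlongrightarrow> deriv zeta_reg s) (at 0)"
        using hol[of s] assms by (simp add: DERIV_deriv_iff_field_differentiable[symmetric] DERIV_def)
      moreover have "filterlim complex_of_real (at 0) (at_right (0::real))"
        by (intro filterlim_atI tendsto_eq_intros) (auto simp: eventually_at_filter)
      ultimately have lim': "((\<lambda>x. zeta_reg (s + of_real x) / of_real x) \<longlongrightarrow> deriv zeta_reg s) (at_right 0)"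
        using filterlim_compose zero by fastforce
      define s2 where "s2 = 1 + 2 * \<i> * of_real t"
      \<comment> \<open>The 3-4-1 inequality, cleared of denominators and divided by
        \<open>x ^ 3\<close>, reads \<open>L x \<le> R x\<close>. Three of the four factors at
        \<open>s\<close> become difference quotients with a finite limit; the fourth tends to
        \<open>0\<close>, whereas \<open>L\<close> tends to a positive number because
        \<open>t \<noteq> 0\<close>.\<close>
      define R where "R x = norm (zeta_reg (1 + of_real x)) ^ 3 * norm (zeta_reg (s + of_real x) / of_real x) ^ 3
         * norm (zeta_reg (s + of_real x)) * norm (zeta_reg (s2 + of_real x))" for x :: real
      define L where "L x = norm (of_real x + \<i> * of_real t) ^ 4 * norm (of_real x + 2 * \<i> * of_real t)" for x :: real
      have "(R \<longlongrightarrow> norm (zeta_reg 1) ^ 3 * norm (deriv zeta_reg s) ^ 3 * norm (zeta_reg s) * norm (zeta_reg s2)) (at_right 0)"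
        unfolding R_def using assms by (intro tendsto_intros lim lim') (auto simp: s2_def)
      then have "(R \<longlongrightarrow> 0) (at_right 0)" using zero by simp
      moreover have "(L \<longlongrightarrow> norm (of_real 0 + \<i> * of_real t) ^ 4 * norm (of_real 0 + 2 * \<i> * of_real t)) (at_right 0)"
        unfolding L_def by (intro tendsto_intros)
      moreover have "\<forall>\<^sub>F x in at_right 0. L x \<le> R x"
      proof -
        have "\<forall>\<^sub>F x in at_right (0::real). x > 0" by (rule eventually_at_right_less)
        then show ?thesis
        proof eventually_elim
          case (elim x)
          define z1 z2 z3 where "z1 = norm (zeta_reg (1 + of_real x))"
            and "z2 = norm (zeta_reg (s + of_real x))" and "z3 = norm (zeta_reg (s2 + of_real x))"
          have g1: "z1 > 0" "norm (moebius_series (1 + of_real x)) = x / z1"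
            using moebius_series_eq[of "1 + of_real x"] elim by (auto simp: z1_def norm_divide)
          have g2: "z2 > 0" "norm (moebius_series (s + of_real x)) = norm (of_real x + \<i> * of_real t) / z2"
            using moebius_series_eq[of "s + of_real x"] elim by (auto simp: z2_def norm_divide s add_ac)
          have g3: "z3 > 0" "norm (moebius_series (s2 + of_real x)) = norm (of_real x + 2 * \<i> * of_real t) / z3"
            using moebius_series_eq[of "s2 + of_real x"] elim by (auto simp: z3_def norm_divide s2_def add_ac)
          have "norm (moebius_series (1 + of_real x)) ^ 3 * norm (moebius_series (s + of_real x)) ^ 4
            * norm (moebius_series (s2 + of_real x)) \<le> 1"
            using three_four_one_moebius_series[of "1 + x" t] elim by (simp add: s s2_def add_ac)
          then have "(x / z1) ^ 3 * (norm (of_real x + \<i> * of_real t) / z2) ^ 4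
             * (norm (of_real x + 2 * \<i> * of_real t) / z3) \<le> 1"
            unfolding g1 g2 g3 .
          then have "x ^ 3 * L x \<le> z1 ^ 3 * z2 ^ 4 * z3"
            using g1(1) g2(1) g3(1) by (simp add: L_def field_simps)
          then have "L x \<le> z1 ^ 3 * z2 ^ 4 * z3 / x ^ 3"
            using elim by (simp add: field_simps)
          also have "\<dots> = R x"
            using elim by (simp add: R_def z1_def[symmetric] z2_def[symmetric] z3_def[symmetric] norm_divide
              power_divide field_simps eval_nat_numeral)
          finally show ?case .
        qed
      qed
      ultimately have "norm (of_real 0 + \<i> * of_real t) ^ 4 * norm (of_real 0 + 2 * \<i> * of_real t) \<le> 0"
        by (intro tendsto_le[of "at_right (0::real)" R _ L]) auto
      then show False using t by (simp add: norm_mult mult_le_0_iff)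
    qed
  qed
qed

section \<open>Newman's theorem\<close>

text \<open>Comparison with the integral of \<open>t powr (x - 1)\<close>. For
  \<open>x \<le> 1\<close> the summand decreases and the integral up to \<open>N\<close> dominates;
  for \<open>x > 1\<close> it increases, each interval dominates only its left end, and the last
  summand is left over.\<close>

lemma sum_powr_le:
  assumes x: "x > 0" and N: "N \<ge> (1::nat)"
  shows "(\<Sum>n = 1..N. real n powr (x - 1)) \<le> real N powr x / x + real N powr (x - 1)"
proof -
  have mvt: "\<exists>z. real n < z \<and> z < real (Suc n) \<and> real (Suc n) powr x / x - real n powr x / x = z powr (x - 1)"
    if "n \<ge> 1" for n :: nat
  proof -
    have "\<exists>z>real n. z < real (Suc n) \<and> real (Suc n) powr x / x - real n powr x / x = (real (Suc n) - real n) * z powr (x - 1)"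
    proof (rule MVT2)
      fix t :: real assume t: "real n \<le> t" "t \<le> real (Suc n)"
      then have "t > 0" using that by linarith
      then show "((\<lambda>t. t powr x / x) has_real_derivative t powr (x - 1)) (at t)"
        using x by (auto intro!: derivative_eq_intros)
    qed simp
    then show ?thesis by auto
  qed
  show ?thesis
  proof (cases "x \<le> 1")
    case True
    have "(\<Sum>n = 1..N. real n powr (x - 1)) \<le> real N powr x / x"
      using N
    proof (induction N rule: dec_induct)
      case base
      show ?case using x True by simp
    next
      case (step n)
      obtain z where z: "real n < z" "z < real (Suc n)"
          "real (Suc n) powr x / x - real n powr x / x = z powr (x - 1)"
        using mvt[of n] step by auto
      have "real (Suc n) powr (x - 1) \<le> z powr (x - 1)"
        using z True by (intro powr_mono2') auto
      then show ?case using step z(3) by simp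
    qed
    then show ?thesis by (smt (verit) powr_ge_zero)
  next
    case False
    show ?thesis
      using N
    proof (induction N rule: dec_induct)
      case base
      show ?case using x by simp
    next
      case (step n)
      obtain z where z: "real n < z" "z < real (Suc n)"
          "real (Suc n) powr x / x - real n powr x / x = z powr (x - 1)"
        using mvt[of n] step by auto
      have "real n powr (x - 1) \<le> z powr (x - 1)"
        using z False by (intro powr_mono2) auto
      then show ?case using step z(3) by simp
    qed
  qed
qed

text \<open>The tail is dominated by the integral of \<open>t powr (- 1 - x)\<close> from
  \<open>N\<close> on, written as the telescoping series of \<open>u\<close>.\<close>

lemma tail_powr_sums_le:
  assumes x: "x > 0" and N: "N \<ge> (1::nat)"
  shows "summable (\<lambda>n. real (n + N + 1) powr (- 1 - x))"
    and "(\<Sum>n. real (n + N + 1) powr (- 1 - x)) \<le> real N powr - x / x"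
proof -
  define u where "u n = - (real (n + N) powr - x / x)" for n
  have le: "real (n + N + 1) powr (- 1 - x) \<le> u (Suc n) - u n" for n
  proof -
    have "\<exists>z>real (n + N). z < real (n + N + 1) \<and> - (real (n + N + 1) powr - x / x) - (- (real (n + N) powr - x / x))
       = (real (n + N + 1) - real (n + N)) * z powr (- x - 1)"
    proof (rule MVT2)
      fix t :: real assume t: "real (n + N) \<le> t" "t \<le> real (n + N + 1)"
      then have "t > 0" using N by linarith
      then show "((\<lambda>t. - (t powr - x / x)) has_real_derivative t powr (- x - 1)) (at t)"
        using x by (auto intro!: derivative_eq_intros)
    qed simp
    then obtain z where z: "z > real (n + N)" "z < real (n + N + 1)" "u (Suc n) - u n = z powr (- x - 1)"
      by (auto simp: u_def add_ac)
    have "real (n + N + 1) powr (- x - 1) \<le> z powr (- x - 1)"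
      using z N x by (intro powr_mono2') auto
    moreover have "- x - 1 = - 1 - x" by simp
    ultimately show ?thesis using z(3) by metis
  qed
  have "(\<lambda>n. real n powr - x) \<longlonglongrightarrow> 0"
    using x by (intro tendsto_neg_powr filterlim_real_sequentially) auto
  then have "(\<lambda>n. real (n + N) powr - x) \<longlonglongrightarrow> 0" by (rule LIMSEQ_ignore_initial_segment)
  then have "(\<lambda>n. - (real (n + N) powr - x / x)) \<longlonglongrightarrow> - (0 / x)"
    using x by (intro tendsto_intros) auto
  then have "u \<longlonglongrightarrow> 0" by (simp add: u_def[abs_def])
  then have sums: "(\<lambda>n. u (Suc n) - u n) sums (0 - u 0)" by (rule telescope_sums)
  show "summable (\<lambda>n. real (n + N + 1) powr (- 1 - x))"
    by (rule summable_comparison_test'[OF sums_summable[OF sums], of 0]) (use le in simp)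
  then have "(\<Sum>n. real (n + N + 1) powr (- 1 - x)) \<le> 0 - u 0"
    using le sums by (intro sums_le[OF _ summable_sums]) auto
  then show "(\<Sum>n. real (n + N + 1) powr (- 1 - x)) \<le> real N powr - x / x"
    by (simp add: u_def)
qed

text \<open>A Riemann-Lebesgue estimate with rate \<open>1 / L\<close>, by one integration by parts;
  the exponential has modulus \<open>1\<close> on the real segment.\<close>

lemma contour_integral_oscillating_le:
  fixes T T' :: "complex \<Rightarrow> complex"
  assumes der: "\<And>w. w \<in> closed_segment (- of_real R) (of_real R) \<Longrightarrow> (T has_field_derivative T' w) (at w)"
    and cont: "continuous_on (closed_segment (- of_real R) (of_real R)) T'"
    and R: "R > 0"
  shows "\<exists>C\<ge>0. \<forall>L>0. norm (contour_integral (linepath (- of_real R) (of_real R)) (\<lambda>w. T w * exp (- \<i> * w * of_real L))) \<le> C / L"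
proof -
  let ?S = "closed_segment (- complex_of_real R) (of_real R)"
  let ?\<gamma> = "linepath (- complex_of_real R) (of_real R)"
  have contT: "continuous_on ?S T"
    using der by (meson DERIV_isCont continuous_at_imp_continuous_on)
  have "compact (T ` ?S)" "compact (T' ` ?S)"
    using contT cont by (auto intro: compact_continuous_image)
  then have "bounded (T ` ?S)" "bounded (T' ` ?S)" by (auto intro: compact_imp_bounded)
  then obtain B B' where "\<And>w. w \<in> ?S \<Longrightarrow> norm (T w) \<le> B" "\<And>w. w \<in> ?S \<Longrightarrow> norm (T' w) \<le> B'"
    by (auto simp: bounded_iff)
  then have B: "\<And>w. w \<in> ?S \<Longrightarrow> norm (T w) \<le> \<bar>B\<bar>" "\<And>w. w \<in> ?S \<Longrightarrow> norm (T' w) \<le> \<bar>B'\<bar>"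
    by (meson abs_ge_self order_trans)+
  have E1: "norm (exp (- \<i> * w * of_real L)) = 1" if "w \<in> ?S" for w L
  proof -
    have "Im w = 0" using that by (auto simp: closed_segment_def)
    then show ?thesis by (simp add: norm_exp_eq_Re)
  qed
  show ?thesis
  proof (intro exI[of _ "2 * \<bar>B\<bar> + \<bar>B'\<bar> * (2 * R)"] conjI allI impI)
    show "0 \<le> 2 * \<bar>B\<bar> + \<bar>B'\<bar> * (2 * R)" using R by simp
  next
    fix L :: real assume L: "L > 0"
    define E where "E w = exp (- \<i> * w * of_real L)" for w
    \<comment> \<open>The factor \<open>\<i> / L\<close> turns \<open>E\<close> into its own
      antiderivative, because \<open>E\<close> has derivative \<open>- \<i> * L * E\<close>.\<close>
    define G where "G w = T w * E w * \<i> / of_real L" for w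
    define D where "D w = T w * E w + T' w * E w * \<i> / of_real L" for w
    have "(G has_field_derivative D w) (at w within ?S)" if "w \<in> ?S" for w
      unfolding G_def D_def E_def
      by (rule has_field_derivative_at_within)
         (use L in \<open>auto intro!: derivative_eq_intros der[OF that] simp: field_simps\<close>)
    then have "(D has_contour_integral (G (pathfinish ?\<gamma>) - G (pathstart ?\<gamma>))) ?\<gamma>"
      by (intro contour_integral_primitive[of ?S]) auto
    then have 1: "(D has_contour_integral (G (of_real R) - G (- of_real R))) ?\<gamma>" by simp
    have contE: "continuous_on ?S E" unfolding E_def by (intro continuous_intros)
    have "(\<lambda>w. T' w * E w * \<i> / of_real L) contour_integrable_on ?\<gamma>"
      using L by (intro contour_integrable_continuous_linepath continuous_intros cont contE) auto
    then obtain J where J: "((\<lambda>w. T' w * E w * \<i> / of_real L) has_contour_integral J) ?\<gamma>"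
      by (auto simp: contour_integrable_on_def)
    have "norm J \<le> \<bar>B'\<bar> / L * norm (of_real R - (- of_real R) :: complex)"
    proof (rule has_contour_integral_bound_linepath[OF J])
      fix w assume "w \<in> ?S"
      then have "norm (T' w) \<le> \<bar>B'\<bar>" "norm (E w) = 1" using B(2) E1 by (auto simp only: E_def)
      then show "norm (T' w * E w * \<i> / of_real L) \<le> \<bar>B'\<bar> / L"
        using L by (simp add: norm_mult norm_divide divide_right_mono)
    qed (use L in auto)
    also have "of_real R - (- of_real R) = complex_of_real (2 * R)" by simp
    finally have nJ: "norm J \<le> \<bar>B'\<bar> * (2 * R) / L" using R by simp
    have nG: "norm (G w) \<le> \<bar>B\<bar> / L" if "w \<in> ?S" for w
    proof -
      have "norm (T w) \<le> \<bar>B\<bar>" "norm (E w) = 1" using B(1) E1 that by (auto simp only: E_def)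
      then show ?thesis using L by (simp add: G_def norm_mult norm_divide divide_right_mono)
    qed
    have "((\<lambda>w. D w - T' w * E w * \<i> / of_real L) has_contour_integral (G (of_real R) - G (- of_real R) - J)) ?\<gamma>"
      by (rule has_contour_integral_diff[OF 1 J])
    then have "contour_integral ?\<gamma> (\<lambda>w. T w * E w) = G (of_real R) - G (- of_real R) - J"
      by (intro contour_integral_unique) (simp add: D_def)
    then have "norm (contour_integral ?\<gamma> (\<lambda>w. T w * E w)) \<le> norm (G (of_real R)) + norm (G (- of_real R)) + norm J"
      by (smt (verit) norm_triangle_ineq4)
    also have "\<dots> \<le> \<bar>B\<bar> / L + \<bar>B\<bar> / L + \<bar>B'\<bar> * (2 * R) / L"
      using nG[of "of_real R"] nG[of "- of_real R"] nJ by simp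
    also have "\<dots> = (2 * \<bar>B\<bar> + \<bar>B'\<bar> * (2 * R)) / L" by (simp add: add_divide_distrib)
    finally show "norm (contour_integral ?\<gamma> (\<lambda>w. T w * exp (- \<i> * w * of_real L)))
       \<le> (2 * \<bar>B\<bar> + \<bar>B'\<bar> * (2 * R)) / L" unfolding E_def .
  qed
qed

text \<open>Newman's contour argument. Since the limit function vanishes at \<open>0\<close>, the contour for it may
  be closed along the imaginary axis instead of to the left of it. The variable is rotated to
  \<open>w = \<i> z\<close>, so that the two half circles are the upper and the lower one.\<close>

lemma newman_estimate:
  fixes a :: "nat \<Rightarrow> complex"
  assumes a: "\<And>n. norm (a n) \<le> 1"
    and U: "open U" "{z. Re z \<ge> 0} \<subseteq> U"
    and hol: "H holomorphic_on U"
    and sums: "\<And>z. Re z > 0 \<Longrightarrow> (\<lambda>n. a n * of_nat n powr (- 1 - z)) sums (z * H z)"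
    and R: "R > 0"
  shows "\<exists>C\<ge>0. \<forall>N\<ge>2. norm (\<Sum>n = 1..N. a n / of_nat n) \<le> 2 / R + 1 / real N + C / ln (real N)"
proof -
  \<comment> \<open>The product of the limit function \<open>z * H z\<close> at
    \<open>z = - \<i> * w\<close> with the kernel \<open>K\<close> below: the zero of the former
    cancels the pole of the latter, so \<open>T\<close> is holomorphic at \<open>0\<close>
    too.\<close>
  define T where "T w = - \<i> * H (- \<i> * w) * (1 - w\<^sup>2 / of_real R ^ 2)" for w
  define V where "V = (\<lambda>w. - \<i> * w) -` U"
  have openV: "open V" unfolding V_def by (intro open_vimage U continuous_intros)
  have holT: "T holomorphic_on V"
    unfolding T_def V_def using R
    by (intro holomorphic_intros holomorphic_on_compose_gen[OF _ hol, unfolded o_def]) auto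
  have upper: "{w. Im w \<ge> 0} \<subseteq> V"
  proof
    fix w assume "w \<in> {w. Im w \<ge> 0}"
    then have "- \<i> * w \<in> {z. Re z \<ge> 0}" by simp
    then show "w \<in> V" using U unfolding V_def by blast
  qed
  let ?seg = "closed_segment (- complex_of_real R) (of_real R)"
  let ?\<gamma> = "linepath (- complex_of_real R) (of_real R)"
  have seg: "?seg \<subseteq> {w. Im w = 0}" by (auto simp: closed_segment_def)
  have segV: "?seg \<subseteq> V"
    by (rule order_trans[OF order_trans[OF seg] upper]) auto
  have "\<exists>C\<ge>0. \<forall>L>0. norm (contour_integral ?\<gamma> (\<lambda>w. T w * exp (- \<i> * w * of_real L))) \<le> C / L"
  proof (rule contour_integral_oscillating_le[where T' = "deriv T"])
    fix w assume "w \<in> ?seg"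
    then show "(T has_field_derivative deriv T w) (at w)"
      using segV by (intro holomorphic_derivI[OF holT openV]) auto
  next
    have "deriv T holomorphic_on V" by (rule holomorphic_deriv[OF holT openV])
    then show "continuous_on ?seg (deriv T)"
      using segV by (intro continuous_on_subset[OF holomorphic_on_imp_continuous_on]) auto
  qed (rule R)
  then obtain C where C: "C \<ge> 0" and osc: "\<And>L. L > 0 \<Longrightarrow>
      norm (contour_integral ?\<gamma> (\<lambda>w. T w * exp (- \<i> * w * of_real L))) \<le> C / L" by blast
  show ?thesis
  proof (intro exI[of _ C] conjI allI impI C)
    fix N :: nat assume N: "N \<ge> 2"
    define L where "L = ln (real N)"
    have L: "L > 0" using N by (simp add: L_def)
    define E where "E w = exp (- \<i> * w * of_real L)" for w
    \<comment> \<open>Newman's kernel. Its residue at \<open>0\<close> is \<open>1\<close>, so the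
      circle integral recovers \<open>S 0\<close>; on \<open>norm w = R\<close> its modulus is
      proportional to \<open>\<bar>Im w\<bar>\<close>, which offsets the factor
      \<open>1 / \<bar>Im w\<bar>\<close> in the bounds for the series.\<close>
    define K where "K w = (1 - w\<^sup>2 / of_real R ^ 2) / w" for w :: complex
    define S where "S w = (\<Sum>n = 1..N. a n * of_nat n powr (- 1 + \<i> * w))" for w
    have normE: "norm (E w) = real N powr (Im w)" for w
      using N by (simp add: E_def norm_exp_eq_Re L_def powr_def mult.commute)
    have normK: "norm (K w) = 2 * \<bar>Im w\<bar> / R ^ 2" if "norm w = R" for w
    proof -
      have "w \<noteq> 0" using that R by auto
      have "w * cnj w = of_real R ^ 2" using complex_norm_square[of w] that by simp
      then have "1 / w = cnj w / of_real R ^ 2" using \<open>w \<noteq> 0\<close> R by (simp add: field_simps)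
      moreover have "K w = 1 / w - w / of_real R ^ 2"
        using \<open>w \<noteq> 0\<close> by (simp add: K_def diff_divide_distrib power2_eq_square)
      ultimately have "K w = (cnj w - w) / of_real R ^ 2" by (simp add: diff_divide_distrib)
      also have "cnj w - w = - 2 * \<i> * of_real (Im w)" by (simp add: complex_eq_iff)
      finally show ?thesis using R by (simp add: norm_divide norm_mult norm_power)
    qed
    have holS: "S holomorphic_on UNIV" unfolding S_def by (intro holomorphic_intros)
    have holE: "E holomorphic_on UNIV" unfolding E_def by (intro holomorphic_intros)
    define P1 P2 where "P1 = part_circlepath 0 R 0 pi" and "P2 = part_circlepath 0 R pi (2 * pi)"
    have P1: "norm w = R" "Im w \<ge> 0" if "w \<in> path_image P1" for w
      using that R by (auto simp: P1_def path_image_part_circlepath Im_exp norm_mult sin_ge_zero)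
    have P2: "norm w = R" "Im w \<le> 0" if "w \<in> path_image P2" for w
    proof -
      obtain x where x: "w = of_real R * exp (\<i> * of_real x)" "pi \<le> x" "x \<le> 2 * pi"
        using \<open>w \<in> path_image P2\<close> by (auto simp: P2_def path_image_part_circlepath)
      have "sin x \<le> 0" using sin_ge_zero[of "x - pi"] x by (simp add: sin_diff)
      then show "norm w = R" "Im w \<le> 0" using x R by (auto simp: norm_mult Im_exp mult_nonneg_nonpos)
    qed
    have contf: "continuous_on A (\<lambda>w. S w * E w * K w)" if "0 \<notin> A" for A
      unfolding K_def using that R
      by (intro continuous_intros continuous_on_subset[OF holomorphic_on_imp_continuous_on[OF holS]]
            continuous_on_subset[OF holomorphic_on_imp_continuous_on[OF holE]]) auto
    have no0: "0 \<notin> path_image P1" "0 \<notin> path_image P2" using P1 P2 R by force+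
    obtain I1 I2 where I1: "((\<lambda>w. S w * E w * K w) has_contour_integral I1) P1"
      and I2: "((\<lambda>w. S w * E w * K w) has_contour_integral I2) P2"
      using contour_integrable_continuous_part_circlepath contf no0
      unfolding contour_integrable_on_def P1_def P2_def by meson
    have S0: "S 0 = (\<Sum>n = 1..N. a n / of_nat n)"
      unfolding S_def by (intro sum.cong) (auto simp: powr_minus_divide)
    have "((\<lambda>w. S w * E w * K w) has_contour_integral (I1 + I2)) (circlepath 0 R)"
      using I1 I2 unfolding P1_def P2_def circlepath_def
      by (auto simp: has_contour_integral_part_circlepath_iff intro: has_integral_combine[of 0 pi "2 * pi"])
    moreover have "((\<lambda>w. S w * E w * K w) has_contour_integral (2 * of_real pi * \<i> * S 0)) (circlepath 0 R)"
    proof -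
      define f where "f w = S w * E w * (1 - w\<^sup>2 / of_real R ^ 2)" for w
      have "f holomorphic_on cball 0 R" unfolding f_def using R
        by (intro holomorphic_intros holomorphic_on_subset[OF holS] holomorphic_on_subset[OF holE]) auto
      from Cauchy_integral_circlepath_simple[OF this, of 0] R
      show ?thesis by (simp add: f_def K_def E_def)
    qed
    ultimately have I12: "I1 + I2 = 2 * of_real pi * \<i> * S 0"
      using has_contour_integral_unique by blast

    \<comment> \<open>Below the real axis the finite sum \<open>S\<close>, which is entire, is
      estimated directly. With \<open>x = - Im w\<close>, \<open>E\<close> contributes
      \<open>N powr - x\<close> and \<open>K\<close> contributes \<open>2 * x / R ^ 2\<close>, so
      everything but the two stated terms cancels.\<close>
    have lower: "norm I2 \<le> (2 / R ^ 2 + 2 / (real N * R)) * R * (2 * pi - pi)"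
    proof (rule has_contour_integral_bound_part_circlepath[OF I2[unfolded P2_def]])
      fix w assume "w \<in> path_image (part_circlepath 0 R pi (2 * pi))"
      then have w: "norm w = R" "Im w \<le> 0" using P2 unfolding P2_def by blast+
      define x where "x = - Im w"
      show "norm (S w * E w * K w) \<le> 2 / R ^ 2 + 2 / (real N * R)"
      proof (cases "x = 0")
        case True
        then show ?thesis using normK[OF w(1)] R by (simp add: norm_mult x_def)
      next
        case False
        then have x: "x > 0" using w by (simp add: x_def)
        have xR: "x \<le> R" using w abs_Im_le_cmod[of w] by (simp add: x_def)
        have "norm (S w) \<le> (\<Sum>n = 1..N. real n powr (x - 1))"
          unfolding S_def
        proof (rule sum_norm_le)
          fix n assume "n \<in> {1..N}"
          show "norm (a n * of_nat n powr (- 1 + \<i> * w)) \<le> real n powr (x - 1)"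
            using mult_right_mono[OF a[of n], of "real n powr (x - 1)"]
            by (simp add: norm_mult norm_nat_powr x_def)
        qed
        also have "\<dots> \<le> real N powr x / x + real N powr (x - 1)"
          using N by (intro sum_powr_le x) auto
        finally have "norm (S w) * (real N powr (- x) * (2 * x / R ^ 2))
            \<le> (real N powr x / x + real N powr (x - 1)) * (real N powr (- x) * (2 * x / R ^ 2))"
          using x by (intro mult_right_mono) auto
        moreover have "norm (S w * E w * K w) = norm (S w) * (real N powr (- x) * (2 * x / R ^ 2))"
          using x by (simp add: norm_mult normE normK[OF w(1)] x_def)
        ultimately have "norm (S w * E w * K w)
            \<le> (real N powr x / x + real N powr (x - 1)) * real N powr (- x) * (2 * x / R ^ 2)"
          by (simp only: mult.assoc)
        also have "\<dots> = 2 / R ^ 2 + 2 * x / (real N * R ^ 2)"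
        proof -
          have "real N powr x * real N powr - x = 1" "real N powr (x - 1) * real N powr - x = 1 / real N"
            using N by (auto simp: powr_minus_divide powr_diff)
          then have "(real N powr x / x + real N powr (x - 1)) * real N powr (- x) = 1 / x + 1 / real N"
            by (simp add: distrib_right)
          then have "(real N powr x / x + real N powr (x - 1)) * real N powr (- x) * (2 * x / R ^ 2)
              = (1 / x + 1 / real N) * (2 * x / R ^ 2)" by (simp only:)
          also have "\<dots> = 2 / R ^ 2 + 2 * x / (real N * R ^ 2)"
            using x R N by (simp add: field_simps)
          finally show ?thesis .
        qed
        also have "2 * x / (real N * R ^ 2) \<le> 2 * R / (real N * R ^ 2)"
          using xR N by (intro divide_right_mono) auto
        also have "2 * R / (real N * R ^ 2) = 2 / (real N * R)" using R by (simp add: power2_eq_square)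
        finally show ?thesis by simp
      qed
    qed (use R in auto)

    define F where "F w = - \<i> * w * H (- \<i> * w)" for w
    have FT: "F w * E w * K w = T w * E w" if "w \<noteq> 0" for w
      using that by (simp add: F_def K_def T_def)
    have holTE: "(\<lambda>w. T w * E w) holomorphic_on {w. Im w \<ge> 0}"
      using upper by (intro holomorphic_intros holomorphic_on_subset[OF holT] holomorphic_on_subset[OF holE]) auto
    have pi1: "path_image (P1 +++ ?\<gamma>) \<subseteq> {w. Im w \<ge> 0}"
      using P1 seg by (intro subset_path_image_join) auto
    \<comment> \<open>There is no pole inside, so the upper arc may be traded for the real segment,
      where the oscillation makes the integral small.\<close>
    have closed: "((\<lambda>w. T w * E w) has_contour_integral 0) (P1 +++ ?\<gamma>)"
      by (rule Cauchy_theorem_convex_simple[OF holTE convex_halfspace_Im_ge _ pi1])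
         (auto simp: P1_def)
    have cont: "continuous_on {w. Im w \<ge> 0} (\<lambda>w. T w * E w)"
      using holTE by (rule holomorphic_on_imp_continuous_on)
    have "(\<lambda>w. T w * E w) contour_integrable_on P1"
      unfolding P1_def
      by (rule contour_integrable_continuous_part_circlepath, rule continuous_on_subset[OF cont])
         (use P1(2) in \<open>auto simp: P1_def\<close>)
    moreover have "(\<lambda>w. T w * E w) contour_integrable_on ?\<gamma>"
      by (rule contour_integrable_continuous_linepath, rule continuous_on_subset[OF cont])
         (rule order_trans[OF seg], auto)
    ultimately obtain J1 J2 where J1: "((\<lambda>w. T w * E w) has_contour_integral J1) P1"
      and J2: "((\<lambda>w. T w * E w) has_contour_integral J2) ?\<gamma>"
      by (auto simp: contour_integrable_on_def)
    have "J1 + J2 = 0"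
      using has_contour_integral_unique[OF has_contour_integral_join[OF J1 J2] closed]
      by (simp add: P1_def)
    moreover have "norm J2 \<le> C / L"
      using osc[OF L] contour_integral_unique[OF J2] by (simp add: E_def)
    ultimately have nJ1: "norm J1 \<le> C / L" by (simp add: add_eq_0_iff2)

    have "((\<lambda>w. T w * E w - S w * E w * K w) has_contour_integral (J1 - I1)) P1"
      by (rule has_contour_integral_diff[OF J1 I1])
    \<comment> \<open>On the upper arc the integrand is the tail \<open>F - S\<close> times
      \<open>E * K\<close>. The tail bound \<open>N powr - x / x\<close> meets
      \<open>N powr x\<close> and \<open>2 * x / R ^ 2\<close>, leaving a constant independent of
      \<open>N\<close>.\<close>
    then have upper_bd: "norm (J1 - I1) \<le> 2 / R ^ 2 * R * (pi - 0)"
      unfolding P1_def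
    proof (rule has_contour_integral_bound_part_circlepath)
      fix w assume "w \<in> path_image (part_circlepath 0 R 0 pi)"
      then have w: "norm w = R" "Im w \<ge> 0" using P1 unfolding P1_def by blast+
      then have "w \<noteq> 0" using R by auto
      define x where "x = Im w"
      have eq: "T w * E w - S w * E w * K w = (F w - S w) * E w * K w"
        unfolding FT[OF \<open>w \<noteq> 0\<close>, symmetric] by (simp only: left_diff_distrib)
      show "norm (T w * E w - S w * E w * K w) \<le> 2 / R ^ 2"
      proof (cases "x = 0")
        case True
        then have "K w = 0" using normK[OF w(1)] by (simp add: x_def)
        then show ?thesis unfolding eq by simp
      next
        case False
        then have x: "x > 0" using w by (simp add: x_def)
        have N1: "N \<ge> 1" using N by simp
        have "(\<lambda>n. a n * of_nat n powr (- 1 + \<i> * w)) sums F w"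
          using sums[of "- \<i> * w"] x by (simp add: F_def x_def)
        then have "(\<lambda>n. a (n + Suc N) * of_nat (n + Suc N) powr (- 1 + \<i> * w))
            sums (F w - (\<Sum>n<Suc N. a n * of_nat n powr (- 1 + \<i> * w)))"
          by (rule sums_split_initial_segment)
        also have "(\<Sum>n<Suc N. a n * of_nat n powr (- 1 + \<i> * w)) = S w"
          unfolding S_def by (rule sum.mono_neutral_right) auto
        finally have tail: "(\<lambda>n. a (n + Suc N) * of_nat (n + Suc N) powr (- 1 + \<i> * w)) sums (F w - S w)" .
        have "norm (F w - S w) \<le> (\<Sum>n. real (n + N + 1) powr (- 1 - x))"
          unfolding sums_unique[OF tail]
        proof (rule norm_suminf_le[OF _ tail_powr_sums_le(1)[OF x N1]])
          fix n
          show "norm (a (n + Suc N) * of_nat (n + Suc N) powr (- 1 + \<i> * w)) \<le> real (n + N + 1) powr (- 1 - x)"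
          proof -
            have re: "Re (- 1 + \<i> * w) = - 1 - x" by (simp add: x_def)
            have "norm (of_nat (n + Suc N) powr (- 1 + \<i> * w) :: complex) = real (n + N + 1) powr (- 1 - x)"
              unfolding norm_nat_powr re by simp
            then show ?thesis
              using mult_right_mono[OF a[of "n + Suc N"], of "real (n + N + 1) powr (- 1 - x)"]
              by (simp only: norm_mult mult_1) simp
          qed
        qed
        also have "\<dots> \<le> real N powr - x / x" by (rule tail_powr_sums_le(2)[OF x N1])
        finally have "norm (F w - S w) * (real N powr x * (2 * x / R ^ 2))
            \<le> real N powr - x / x * (real N powr x * (2 * x / R ^ 2))"
          using x by (intro mult_right_mono) auto
        moreover have "norm ((F w - S w) * E w * K w) = norm (F w - S w) * (real N powr x * (2 * x / R ^ 2))"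
          using x by (simp add: norm_mult normE normK[OF w(1)] x_def)
        ultimately have "norm ((F w - S w) * E w * K w) \<le> real N powr - x / x * real N powr x * (2 * x / R ^ 2)"
          by (simp only: mult.assoc)
        also have "\<dots> = 2 / R ^ 2"
          using x N by (simp add: powr_minus_divide)
        finally show ?thesis using eq by simp
      qed
    qed (use R in auto)
    \<comment> \<open>After division by \<open>2 * pi\<close>, each arc costs \<open>1 / R\<close>,
      the lower one also \<open>1 / N\<close>; \<open>J1\<close> is the segment contribution up to
      sign.\<close>
    have "2 * pi * norm (S 0) = norm (J1 - (J1 - I1) + I2)"
      using I12 by (simp add: norm_mult)
    also have "\<dots> \<le> norm J1 + norm (J1 - I1) + norm I2"
      by (smt (verit) norm_triangle_ineq norm_triangle_ineq4)
    also have "\<dots> \<le> C / L + 2 * pi / R + (2 * pi / R + 2 * pi / real N)"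
    proof (intro add_mono nJ1)
      show "norm (J1 - I1) \<le> 2 * pi / R"
        using upper_bd R by (simp add: power2_eq_square)
      show "norm I2 \<le> 2 * pi / R + 2 * pi / real N"
      proof -
        have "(2 / R ^ 2 + 2 / (real N * R)) * R = 2 / R + 2 / real N"
          using R N by (simp add: distrib_right power2_eq_square)
        then have "(2 / R ^ 2 + 2 / (real N * R)) * R * (2 * pi - pi) \<le> 2 * pi / R + 2 * pi / real N"
          using R N by (simp add: field_simps)
        then show ?thesis using lower by (rule order_trans[rotated])
      qed
    qed
    finally have "norm (S 0) \<le> (C / L + 2 * pi / R + (2 * pi / R + 2 * pi / real N)) / (2 * pi)"
      by (simp add: field_simps)
    also have "\<dots> = 2 / R + 1 / real N + C / L / (2 * pi)"
      by (simp add: add_divide_distrib)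
    also have "C / L / (2 * pi) \<le> C / L / 1"
      using C L pi_gt3 by (intro divide_left_mono) auto
    finally show "norm (\<Sum>n = 1..N. a n / of_nat n) \<le> 2 / R + 1 / real N + C / ln (real N)"
      by (simp add: S0 L_def)
  qed
qed

text \<open>The constant \<open>C\<close> depends on \<open>R\<close>, so \<open>R\<close> is fixed
  first: \<open>R = 4 / e\<close> holds the arcs to \<open>e / 2\<close>, and the remaining terms
  vanish as \<open>N\<close> grows.\<close>

lemma newman_tauberian:
  fixes a :: "nat \<Rightarrow> complex"
  assumes a: "\<And>n. norm (a n) \<le> 1"
    and U: "open U" "{z. Re z \<ge> 0} \<subseteq> U"
    and hol: "H holomorphic_on U"
    and sums: "\<And>z. Re z > 0 \<Longrightarrow> (\<lambda>n. a n * of_nat n powr (- 1 - z)) sums (z * H z)"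
  shows "(\<lambda>N. \<Sum>n = 1..N. a n / of_nat n) \<longlonglongrightarrow> 0"
proof (rule tendstoI)
  fix e :: real assume e: "e > 0"
  define R where "R = 4 / e"
  have R: "R > 0" using e by (simp add: R_def)
  obtain C where C: "\<And>N. N \<ge> 2 \<Longrightarrow> norm (\<Sum>n = 1..N. a n / of_nat n) \<le> 2 / R + 1 / real N + C / ln (real N)"
    using newman_estimate[OF a U hol sums R] by blast
  have "filterlim (\<lambda>N. ln (real N)) at_top sequentially"
    by (rule filterlim_compose[OF ln_at_top filterlim_real_sequentially])
  then have "(\<lambda>N. 1 / real N + C / ln (real N)) \<longlonglongrightarrow> 0 + 0"
    by (intro tendsto_add lim_1_over_n tendsto_divide_0[OF tendsto_const] filterlim_at_top_imp_at_infinity)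
  then have "\<forall>\<^sub>F N in sequentially. 1 / real N + C / ln (real N) < e / 2"
    using e by (intro order_tendstoD) auto
  then show "\<forall>\<^sub>F N in sequentially. dist (\<Sum>n = 1..N. a n / of_nat n) 0 < e"
    using eventually_ge_at_top[of 2]
  proof eventually_elim
    case (elim N)
    have "2 / R = e / 2" by (simp add: R_def)
    then have "norm (\<Sum>n = 1..N. a n / of_nat n) < e" using C[OF elim(2)] elim(1) by linarith
    then show ?case by (simp add: dist_norm)
  qed
qed

section \<open>Sums over the Moebius function\<close>

text \<open>The Dirichlet series at \<open>1 + z\<close> is the reciprocal of zeta, that is
  \<open>z / zeta_reg (1 + z)\<close>. Its explicit factor \<open>z\<close> is the one that Newman's
  theorem asks for, and non-vanishing on the line makes \<open>1 / zeta_reg (1 + z)\<close>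
  holomorphic on a neighbourhood \<open>U\<close> of the closed half plane.\<close>

lemma sum_moebius_over_n_tendsto_0: "(\<lambda>N. \<Sum>n = 1..N. of_int (moebius n) / of_nat n :: complex) \<longlonglongrightarrow> 0"
proof (rule newman_tauberian[OF norm_moebius_le])
  define U where "U = {z. Re z > - 1} \<inter> (\<lambda>z. zeta_reg (1 + z)) -` (- {0})"
  have hol: "(\<lambda>z. zeta_reg (1 + z)) holomorphic_on {z. Re z > - 1}"
    by (intro holomorphic_on_compose_gen[OF _ holomorphic_zeta_reg, unfolded o_def] holomorphic_intros) auto
  show "open U"
    unfolding U_def
    by (intro continuous_open_preimage holomorphic_on_imp_continuous_on hol open_halfspace_Re_gt) auto
  show "{z. Re z \<ge> 0} \<subseteq> U"
    using zeta_reg_nonzero by (auto simp: U_def)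
  show "(\<lambda>z. 1 / zeta_reg (1 + z)) holomorphic_on U"
    by (intro holomorphic_intros holomorphic_on_subset[OF hol]) (auto simp: U_def)
  fix z :: complex assume z: "Re z > 0"
  have "summable (\<lambda>n. of_int (moebius n) * of_nat n powr - (1 + z) :: complex)"
    using z by (intro summable_norm_cancel[OF summable_bounded_dirichlet[OF _ norm_moebius_le]]) auto
  then have "(\<lambda>n. of_int (moebius n) * of_nat n powr - (1 + z)) sums moebius_series (1 + z)"
    unfolding moebius_series_def by (rule summable_sums)
  then show "(\<lambda>n. of_int (moebius n) * of_nat n powr (- 1 - z)) sums (z * (1 / zeta_reg (1 + z)))"
    using moebius_series_eq(2)[of "1 + z"] z by simp
qed

text \<open>The recursion is a contraction by one half up to an error tending to \<open>0\<close>.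
  It serves to remove one prime at a time from the Moebius sums.\<close>

lemma tendsto_zero_self_similar:
  fixes f g :: "nat \<Rightarrow> complex"
  assumes p: "p \<ge> 2" and c: "norm c \<le> 1 / 2" and f0: "f 0 = 0"
    and eq: "\<And>N. f N = g N + c * f (N div p)" and g: "g \<longlonglongrightarrow> 0"
  shows "f \<longlonglongrightarrow> 0"
proof -
  have "Bseq g" using g convergentI convergent_imp_Bseq by blast
  then obtain B where B: "B > 0" "\<And>N. norm (g N) \<le> B" by (auto elim!: BseqE)
  have step: "norm (f N) \<le> norm (g N) + norm (f (N div p)) / 2" for N
  proof -
    have "norm (f N) \<le> norm (g N) + norm c * norm (f (N div p))"
      by (subst eq) (metis norm_triangle_ineq norm_mult)
    also have "norm c * norm (f (N div p)) \<le> 1 / 2 * norm (f (N div p))"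
      using c by (intro mult_right_mono) auto
    finally show ?thesis by simp
  qed
  \<comment> \<open>\<open>2 * B\<close> is the fixed point of the bound
    \<open>b = B + b / 2\<close>.\<close>
  have bd: "norm (f N) \<le> 2 * B" for N
  proof (induction N rule: less_induct)
    case (less N)
    show ?case
    proof (cases "N = 0")
      case False
      then have "N div p < N" using p by simp
      then show ?thesis using less[of "N div p"] step[of N] B(2)[of N] by linarith
    qed (use f0 B in simp)
  qed
  \<comment> \<open>Each application of the recursion halves the excess over \<open>e / 2\<close>,
    which is itself the fixed point once \<open>g\<close> is below \<open>e / 4\<close>; the price
    is a larger threshold \<open>M\<close>.\<close>
  have ev: "\<exists>M. \<forall>N\<ge>M. norm (f N) \<le> e / 2 + 2 * B / 2 ^ k" if e: "e > 0" for e k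
  proof (induction k)
    case 0
    have "norm (f N) \<le> e / 2 + 2 * B / 2 ^ 0" for N using bd[of N] e by simp
    then show ?case by blast
  next
    case (Suc k)
    then obtain M where M: "\<And>N. N \<ge> M \<Longrightarrow> norm (f N) \<le> e / 2 + 2 * B / 2 ^ k" by blast
    obtain M0 where M0: "\<And>N. N \<ge> M0 \<Longrightarrow> norm (g N) < e / 4"
      using LIMSEQ_D[OF g, of "e / 4"] e by auto
    have "norm (f N) \<le> e / 2 + 2 * B / 2 ^ Suc k" if N: "N \<ge> max M0 (M * p)" for N
    proof -
      define c where "c = e / 2 + 2 * B / 2 ^ k"
      have "N div p \<ge> M" using N p by (simp add: less_eq_div_iff_mult_less_eq)
      then have "norm (f (N div p)) \<le> c" unfolding c_def by (rule M)
      moreover have "norm (g N) < e / 4" using M0 N by simp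
      ultimately have "norm (f N) \<le> e / 4 + c / 2"
        using step[of N] by linarith
      also have "\<dots> = e / 2 + 2 * B / 2 ^ Suc k" by (simp add: c_def add_divide_distrib)
      finally show ?thesis .
    qed
    then show ?case by blast
  qed
  show ?thesis
  proof (rule LIMSEQ_I)
    fix e :: real assume e: "e > 0"
    obtain k where k: "2 * B / 2 ^ k < e / 2"
    proof -
      have "(\<lambda>k. 2 * B * (1 / 2) ^ k) \<longlonglongrightarrow> 2 * B * 0"
        by (intro tendsto_mult_left LIMSEQ_power_zero) auto
      then have "\<forall>\<^sub>F k in sequentially. 2 * B * (1 / 2) ^ k < e / 2"
        using e by (intro order_tendstoD) auto
      then obtain k where "2 * B * (1 / 2) ^ k < e / 2" by (meson eventually_sequentially order_refl)
      then show ?thesis using that[of k] by (simp add: power_divide)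
    qed
    obtain M where "\<And>N. N \<ge> M \<Longrightarrow> norm (f N) \<le> e / 2 + 2 * B / 2 ^ k" using ev[OF e, of k] by blast
    then have "\<forall>N\<ge>M. norm (f N - 0) < e" using k by fastforce
    then show "\<exists>M. \<forall>N\<ge>M. norm (f N - 0) < e" ..
  qed
qed

lemma sum_multiples:
  fixes k :: nat
  assumes k: "k \<ge> 1"
  shows "(\<Sum>n | n \<in> {1..N} \<and> k dvd n. h n) = (\<Sum>e = 1..N div k. h (k * e))"
proof (rule sum.reindex_bij_witness[where i = "\<lambda>e. k * e" and j = "\<lambda>n. n div k"])
  fix n assume n: "n \<in> {n. n \<in> {1..N} \<and> k dvd n}"
  then obtain e where e: "n = k * e" by (auto elim: dvdE)
  show "k * (n div k) = n" "h (k * (n div k)) = h n" using n by auto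
  show "n div k \<in> {1..N div k}" using n e k by (auto simp: less_eq_div_iff_mult_less_eq mult.commute Suc_le_eq)
next
  fix e assume "e \<in> {1..N div k}"
  then show "k * e div k = e" "k * e \<in> {n. n \<in> {1..N} \<and> k dvd n}"
    using k by (auto simp: less_eq_div_iff_mult_less_eq mult.commute Suc_le_eq)
qed

text \<open>Induction on the excluded primes. Among the \<open>n\<close> avoiding \<open>P\<close>,
  those divisible by \<open>p\<close> are \<open>p * e\<close>; the Moebius function vanishes there
  unless \<open>p\<close> does not divide \<open>e\<close>, and then only changes sign. So the new
  sum at \<open>N\<close> is the old one plus \<open>1 / p\<close> times the new one at
  \<open>N div p\<close>.\<close>

lemma sum_moebius_coprime_tendsto_0:
  assumes "finite P" "\<And>p. p \<in> P \<Longrightarrow> prime (p :: nat)"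
  shows "(\<lambda>N. \<Sum>n | n \<in> {1..N} \<and> (\<forall>p\<in>P. \<not> p dvd n). of_int (moebius n) / of_nat n :: complex) \<longlonglongrightarrow> 0"
  using assms
proof (induction P rule: finite_induct)
  case empty
  have "{n. n \<in> {1..N} \<and> (\<forall>p\<in>{}. \<not> p dvd n)} = {1..N}" for N :: nat by auto
  then show ?case using sum_moebius_over_n_tendsto_0 by simp
next
  case (insert p P)
  let ?A = "\<lambda>P N. {n. n \<in> {1..N} \<and> (\<forall>p\<in>P. \<not> p dvd n)}"
  let ?t = "\<lambda>n. of_int (moebius n) / of_nat n :: complex"
  have p: "prime p" "p \<ge> 2" using insert prime_ge_2_nat by auto
  show ?case
  proof (rule tendsto_zero_self_similar[OF p(2), of "1 / of_nat p"])
    show "norm (1 / of_nat p :: complex) \<le> 1 / 2"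
      using p by (simp add: norm_divide divide_le_eq)
    show "(\<lambda>N. sum ?t (?A P N)) \<longlonglongrightarrow> 0" using insert by auto
    show "sum ?t (?A (insert p P) N) = sum ?t (?A P N) + 1 / of_nat p * sum ?t (?A (insert p P) (N div p))" for N
    proof -
      have "sum ?t (?A P N) = sum ?t (?A (insert p P) N) + sum ?t {n \<in> ?A P N. p dvd n}"
        by (subst sum.union_disjoint[symmetric]) (auto intro!: sum.cong)
      also have "sum ?t {n \<in> ?A P N. p dvd n}
          = (\<Sum>n | n \<in> {1..N} \<and> p dvd n. if \<forall>r\<in>P. \<not> r dvd n then ?t n else 0)"
        by (rule sum.mono_neutral_cong_left) auto
      also have "\<dots> = (\<Sum>e = 1..N div p. if \<forall>r\<in>P. \<not> r dvd p * e then ?t (p * e) else 0)"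
        using p by (intro sum_multiples) auto
      also have "\<dots> = (\<Sum>e\<in>?A P (N div p). ?t (p * e))"
      proof (rule sum.mono_neutral_cong_right)
        have *: "r dvd p * e \<longleftrightarrow> r dvd e" if "r \<in> P" for r e
        proof -
          have "prime r" "r \<noteq> p" using that insert by auto
          then show ?thesis using p(1) by (metis dvd_mult prime_dvd_mult_nat primes_dvd_imp_eq)
        qed
        show "\<forall>e\<in>{1..N div p} - ?A P (N div p). (if \<forall>r\<in>P. \<not> r dvd p * e then ?t (p * e) else 0) = 0"
          using * by auto
        show "\<And>e. e \<in> ?A P (N div p) \<Longrightarrow> (if \<forall>r\<in>P. \<not> r dvd p * e then ?t (p * e) else 0) = ?t (p * e)"
          using * by auto
      qed auto
      also have "\<dots> = (\<Sum>e\<in>?A (insert p P) (N div p). - (1 / of_nat p) * ?t e)"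
      proof (rule sum.mono_neutral_cong_right)
        show "\<forall>e\<in>?A P (N div p) - ?A (insert p P) (N div p). ?t (p * e) = 0"
          using p moebius_prime_square_dvd by auto
        fix e assume "e \<in> ?A (insert p P) (N div p)"
        then show "?t (p * e) = - (1 / of_nat p) * ?t e"
          using p moebius_prime_mult[of p e] by simp
      qed auto
      finally show ?thesis by (simp add: sum_distrib_left sum_negf)
    qed
  qed simp
qed

lemma moebius_mult:
  "moebius (k * e) = (if coprime k e then moebius k * moebius e else 0)"
proof (cases "coprime k e")
  case True
  show ?thesis
  proof (cases "squarefree k \<and> squarefree e")
    case sf: True
    then have nz: "k \<noteq> 0" "e \<noteq> 0" by (metis not_squarefree_0)+
    have "squarefree (k * e)" using True sf squarefree_mult_coprime by blast
    moreover have "card (prime_factors (k * e)) = card (prime_factors k) + card (prime_factors e)"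
    proof -
      have "prime_factors k \<inter> prime_factors e = {}"
        using True by (auto simp: in_prime_factors_iff dest: coprime_common_divisor)
      then show ?thesis using nz by (simp add: prime_factors_product card_Un_disjoint)
    qed
    ultimately show ?thesis using True sf by (simp add: moebius_def power_add)
  next
    case False
    then have "\<not> squarefree (k * e)" using squarefree_multD by blast
    then have "moebius (k * e) = 0" unfolding moebius_def by (rule if_not_P)
    moreover have "moebius k = 0 \<or> moebius e = 0" using False unfolding moebius_def by presburger
    ultimately show ?thesis by auto
  qed
next
  case False
  have "\<not> is_unit (gcd k e)" using False by (simp only: is_unit_gcd not_False_eq_True)
  moreover have "gcd k e ^ 2 dvd k * e" by (simp add: power2_eq_square mult_dvd_mono)
  ultimately have "\<not> squarefree (k * e)" by (rule not_squarefreeI[rotated])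
  then have "moebius (k * e) = 0" unfolding moebius_def by (rule if_not_P)
  then show ?thesis using False by (simp only: if_False)
qed

lemma filterlim_div_sequentially:
  assumes "k \<ge> (1::nat)"
  shows "filterlim (\<lambda>N. N div k) sequentially sequentially"
  unfolding filterlim_at_top
proof
  fix Z
  show "\<forall>\<^sub>F N in sequentially. Z \<le> N div k"
    using eventually_ge_at_top[of "Z * k"] by eventually_elim (use assms in \<open>simp add: less_eq_div_iff_mult_less_eq\<close>)
qed

text \<open>With \<open>n = k * e\<close> only the \<open>e\<close> coprime to \<open>k\<close>
  survive, and a constant factor splits off; the rest is the sum avoiding the primes of
  \<open>k\<close>.\<close>

lemma sum_moebius_multiples_tendsto_0:
  assumes k: "k \<ge> 1"
  shows "(\<lambda>N. \<Sum>n = 1..N. (if k dvd n then of_int (moebius n) else 0) / of_nat n :: complex) \<longlonglongrightarrow> 0"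
proof -
  define A where "A N = (\<Sum>n | n \<in> {1..N} \<and> (\<forall>p\<in>prime_factors k. \<not> p dvd n). of_int (moebius n) / of_nat n :: complex)" for N :: nat
  have "A \<longlonglongrightarrow> 0" unfolding A_def by (rule sum_moebius_coprime_tendsto_0) auto
  then have "(\<lambda>N. A (N div k)) \<longlonglongrightarrow> 0"
    by (rule filterlim_compose[OF _ filterlim_div_sequentially[OF k]])
  then have lim: "(\<lambda>N. of_int (moebius k) / of_nat k * A (N div k)) \<longlonglongrightarrow> 0"
    by (rule tendsto_mult_right_zero)
  have "(\<Sum>n = 1..N. (if k dvd n then of_int (moebius n) else 0) / of_nat n :: complex)
      = of_int (moebius k) / of_nat k * A (N div k)" for N
  proof -
    have "(\<Sum>n = 1..N. (if k dvd n then of_int (moebius n) else 0) / of_nat n :: complex)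
       = (\<Sum>n | n \<in> {1..N} \<and> k dvd n. of_int (moebius n) / of_nat n)"
      by (rule sum.mono_neutral_cong_right) auto
    also have "\<dots> = (\<Sum>e = 1..N div k. of_int (moebius (k * e)) / of_nat (k * e))"
      by (rule sum_multiples[OF k])
    also have "\<dots> = (\<Sum>n | n \<in> {1..N div k} \<and> (\<forall>p\<in>prime_factors k. \<not> p dvd n).
        of_int (moebius k) / of_nat k * (of_int (moebius n) / of_nat n))"
    proof (rule sum.mono_neutral_cong_right)
      have cop: "coprime k e \<longleftrightarrow> (\<forall>p\<in>prime_factors k. \<not> p dvd e)" for e
      proof
        assume "coprime k e"
        then show "\<forall>p\<in>prime_factors k. \<not> p dvd e"
          by (auto simp: in_prime_factors_iff dest: coprime_common_divisor)
      next
        assume *: "\<forall>p\<in>prime_factors k. \<not> p dvd e"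
        show "coprime k e"
        proof (rule ccontr)
          assume "\<not> coprime k e"
          then obtain p where "prime p" "p dvd gcd k e"
            by (metis coprime_iff_gcd_eq_1 prime_factor_nat)
          then show False using * k by (auto simp: in_prime_factors_iff)
        qed
      qed
      show "\<forall>e\<in>{1..N div k} - {n. n \<in> {1..N div k} \<and> (\<forall>p\<in>prime_factors k. \<not> p dvd n)}.
         complex_of_int (moebius (k * e)) / of_nat (k * e) = 0"
        unfolding cop[symmetric] by (auto simp: moebius_mult)
      fix e assume "e \<in> {n. n \<in> {1..N div k} \<and> (\<forall>p\<in>prime_factors k. \<not> p dvd n)}"
      then have "coprime k e" unfolding cop by simp
      then show "complex_of_int (moebius (k * e)) / of_nat (k * e)
         = of_int (moebius k) / of_nat k * (of_int (moebius e) / of_nat e)"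
        by (simp add: moebius_mult)
    qed auto
    finally show ?thesis by (simp add: A_def sum_distrib_left)
  qed
  then show ?thesis using lim by simp
qed

section \<open>Abel summation and the hyperbola method\<close>

text \<open>Abel summation: the boundary term and the tail of the transformed series each cost
  \<open>B / (N + 1)\<close>. The explicit rate is what the range of small \<open>d\<close> in the
  hyperbola method requires.\<close>

lemma partial_summation_error:
  fixes b :: "nat \<Rightarrow> complex"
  assumes B: "\<And>N. norm (\<Sum>n = 1..N. b n) \<le> B"
  shows "\<exists>L. \<forall>N. norm ((\<Sum>n = 1..N. b n / of_nat n) - L) \<le> 2 * B / real (Suc N)"
proof -
  define T where "T N = (\<Sum>n = 1..N. b n)" for N
  define w where "w n = 1 / real (Suc n) - 1 / real (Suc (Suc n))" for n
  define u where "u n = T (Suc n) * of_real (w n)" for n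
  have w: "w n \<ge> 0" for n by (simp add: w_def field_simps)
  have "(\<lambda>n. 1 / real (Suc n)) \<longlonglongrightarrow> 0" by (rule LIMSEQ_Suc[OF lim_1_over_n])
  then have "(\<lambda>n. - (1 / real (Suc (n + N)))) \<longlonglongrightarrow> - 0" for N
    by (intro tendsto_minus) (rule LIMSEQ_ignore_initial_segment)
  from telescope_sums[OF this] have wsums: "(\<lambda>n. w (n + N)) sums (1 / real (Suc N))" for N
    by (simp add: w_def)
  have ule: "norm (u n) \<le> B * w n" for n
    using B[of "Suc n"] w[of n] by (simp add: u_def T_def norm_mult mult_right_mono)
  have sumB: "(\<lambda>n. B * w (n + N)) sums (B * (1 / real (Suc N)))" for N
    by (rule sums_mult[OF wsums])
  have usummable: "summable u"
    by (rule summable_comparison_test'[of "\<lambda>n. B * w n" 0]) (use sumB[of 0] ule in \<open>auto simp: sums_iff\<close>)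
  have parts: "(\<Sum>n = 1..N. b n / of_nat n) = T N / of_nat (Suc N) + (\<Sum>n<N. u n)" for N
  proof (induction N)
    case (Suc N)
    have TS: "T (Suc N) = T N + b (Suc N)" by (simp add: T_def)
    show ?case using Suc
      by (simp add: u_def w_def TS diff_divide_distrib add_divide_distrib algebra_simps del: of_nat_Suc)
  qed (simp add: T_def)
  show ?thesis
  proof (intro exI allI)
    fix N
    have "(\<lambda>n. u (n + N)) sums (suminf u - (\<Sum>n<N. u n))"
      by (rule sums_split_initial_segment[OF summable_sums[OF usummable]])
    then have "norm (suminf u - (\<Sum>n<N. u n)) \<le> B * (1 / real (Suc N))"
      using norm_suminf_le[of "\<lambda>n. u (n + N)" "\<lambda>n. B * w (n + N)"] ule sumB[of N] by (auto simp: sums_iff)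
    moreover have "norm (T N / of_nat (Suc N)) \<le> B / real (Suc N)"
      using B[of N] by (simp add: T_def norm_divide divide_right_mono del: of_nat_Suc)
    moreover have "norm ((\<Sum>n = 1..N. b n / of_nat n) - suminf u)
        = norm (T N / of_nat (Suc N) - (suminf u - (\<Sum>n<N. u n)))"
      unfolding parts by (simp only: diff_diff_eq2 add.commute)
    ultimately have "norm ((\<Sum>n = 1..N. b n / of_nat n) - suminf u) \<le> B / real (Suc N) + B * (1 / real (Suc N))"
      using norm_triangle_ineq4[of "T N / of_nat (Suc N)" "suminf u - (\<Sum>n<N. u n)"] by linarith
    also have "\<dots> = 2 * B / real (Suc N)" by simp
    finally show "norm ((\<Sum>n = 1..N. b n / of_nat n) - suminf u) \<le> 2 * B / real (Suc N)" .
  qed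
qed

lemma sum_divisors_eq_sum_hyperbola:
  fixes a b :: "nat \<Rightarrow> complex"
  shows "(\<Sum>m = 1..N. (\<Sum>d | d dvd m. a d * b (m div d)) / of_nat m)
     = (\<Sum>d = 1..N. a d / of_nat d * (\<Sum>t = 1..N div d. b t / of_nat t))"
proof -
  have "(\<Sum>m = 1..N. (\<Sum>d | d dvd m. a d * b (m div d)) / of_nat m)
     = (\<Sum>(m, d)\<in>Sigma {1..N} (\<lambda>m. {d. d dvd m}). a d * b (m div d) / of_nat m)"
    by (subst sum.Sigma[symmetric]) (auto simp: sum_divide_distrib)
  also have "\<dots> = (\<Sum>(d, t)\<in>Sigma {1..N} (\<lambda>d. {1..N div d}). a d / of_nat d * (b t / of_nat t))"
  proof (rule sum.reindex_bij_witness[where i = "\<lambda>(d, t). (d * t, d)" and j = "\<lambda>(m, d). (d, m div d)"])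
    fix p assume "p \<in> Sigma {1..N} (\<lambda>m. {d. d dvd m})"
    then obtain d t where p: "p = (d * t, d)" "1 \<le> d * t" "d * t \<le> N" by (auto elim: dvdE)
    then have pos: "d > 0" "t > 0" by (auto simp: Suc_le_eq)
    then have "d * 1 \<le> d * t" by (intro mult_le_mono2) auto
    then have "d \<le> N" using p(3) by linarith
    then show "(\<lambda>(m, d). (d, m div d)) p \<in> Sigma {1..N} (\<lambda>d. {1..N div d})"
      using p pos by (auto simp: less_eq_div_iff_mult_less_eq mult.commute)
    show "(\<lambda>(d, t). (d * t, d)) ((\<lambda>(m, d). (d, m div d)) p) = p"
      "(case (\<lambda>(m, d). (d, m div d)) p of (d, t) \<Rightarrow> a d / of_nat d * (b t / of_nat t))
        = (case p of (m, d) \<Rightarrow> a d * b (m div d) / of_nat m)"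
      using p pos by auto
  next
    fix p assume "p \<in> Sigma {1..N} (\<lambda>d. {1..N div d})"
    then obtain d t where p: "p = (d, t)" "1 \<le> d" "1 \<le> t" "t \<le> N div d" by auto
    then show "(\<lambda>(m, d). (d, m div d)) ((\<lambda>(d, t). (d * t, d)) p) = p"
      "(\<lambda>(d, t). (d * t, d)) p \<in> Sigma {1..N} (\<lambda>m. {d. d dvd m})"
      by (auto simp: less_eq_div_iff_mult_less_eq mult.commute)
  qed
  also have "\<dots> = (\<Sum>d = 1..N. a d / of_nat d * (\<Sum>t = 1..N div d. b t / of_nat t))"
    by (subst sum.Sigma[symmetric]) (auto simp: sum_distrib_left)
  finally show ?thesis .
qed

text \<open>Dirichlet's hyperbola method: large \<open>d\<close> are grouped by the value of \<open>N div d\<close>, which takes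
  boundedly many values on them.\<close>

lemma sum_dirichlet_product_tendsto_0:
  fixes a b :: "nat \<Rightarrow> complex"
  assumes a: "\<And>n. norm (a n) \<le> 1" and lim: "(\<lambda>N. \<Sum>n = 1..N. a n / of_nat n) \<longlonglongrightarrow> 0"
    and B: "\<And>N. norm (\<Sum>n = 1..N. b n) \<le> B"
  shows "(\<lambda>N. \<Sum>m = 1..N. (\<Sum>d | d dvd m. a d * b (m div d)) / of_nat m) \<longlonglongrightarrow> 0"
proof -
  define A where "A N = (\<Sum>n = 1..N. a n / of_nat n)" for N
  obtain L where L: "\<And>N. norm ((\<Sum>n = 1..N. b n / of_nat n) - L) \<le> 2 * B / real (Suc N)"
    using partial_summation_error[OF B] by blast
  define r where "r N = (\<Sum>n = 1..N. b n / of_nat n) - L" for N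
  have B0: "B \<ge> 0" using B[of 0] by simp
  have Alim: "A \<longlonglongrightarrow> 0" using lim by (simp add: A_def[abs_def])
  \<comment> \<open>Going from \<open>K\<close> to \<open>Suc K\<close> adds exactly the block of
    \<open>d\<close> with \<open>N div d = K\<close>, where \<open>r\<close> is constant and the sum
    over \<open>d\<close> is a difference of values of \<open>A\<close>.\<close>
  have large: "(\<Sum>d\<in>{N div K<..N}. a d / of_nat d * r (N div d))
      = (\<Sum>j = 1..<K. r j * (A (N div j) - A (N div Suc j)))" if "K \<ge> 1" for N K
    using that
  proof (induction K rule: dec_induct)
    case (step K)
    have le: "N div Suc K \<le> N div K" "N div K \<le> N" using step by (auto intro: div_le_mono2)
    then have "{N div Suc K<..N} = {N div K<..N} \<union> {N div Suc K<..N div K}"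
      by (auto intro: order_trans[OF _ le(2)])
    then have "(\<Sum>d\<in>{N div Suc K<..N}. a d / of_nat d * r (N div d))
       = (\<Sum>d\<in>{N div K<..N}. a d / of_nat d * r (N div d)) + (\<Sum>d\<in>{N div Suc K<..N div K}. a d / of_nat d * r (N div d))"
      by (simp add: sum.union_disjoint)
    also have "(\<Sum>d\<in>{N div Suc K<..N div K}. a d / of_nat d * r (N div d))
       = (\<Sum>d\<in>{N div Suc K<..N div K}. r K * (a d / of_nat d))"
    proof (rule sum.cong)
      fix d assume d: "d \<in> {N div Suc K<..N div K}"
      then have d0: "d > 0" by auto
      have "d * K \<le> N" using d step by (simp add: less_eq_div_iff_mult_less_eq)
      then have "K \<le> N div d" using d0 by (simp add: less_eq_div_iff_mult_less_eq mult.commute)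
      moreover have "N < d * Suc K" using d by (simp add: div_less_iff_less_mult del: mult_Suc_right)
      then have "N div d < Suc K" using d0 by (simp add: div_less_iff_less_mult mult.commute del: mult_Suc_right mult_Suc)
      ultimately have "N div d = K" by simp
      then show "a d / of_nat d * r (N div d) = r K * (a d / of_nat d)" by simp
    qed simp
    also have "\<dots> = r K * (A (N div K) - A (N div Suc K))"
    proof -
      have "{1..N div K} = {1..N div Suc K} \<union> {N div Suc K<..N div K}" using le by auto
      then have "A (N div K) = A (N div Suc K) + (\<Sum>d\<in>{N div Suc K<..N div K}. a d / of_nat d)"
        unfolding A_def by (simp only:) (rule sum.union_disjoint, auto)
      then show ?thesis by (simp add: sum_distrib_left)
    qed
    finally show ?case using step by simp
  qed simp
  \<comment> \<open>The rate for \<open>r\<close> at \<open>N div d\<close> is at most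
    \<open>2 * B * d / N\<close>; the weight \<open>1 / d\<close> cancels \<open>d\<close>, and
    there are at most \<open>N / K\<close> such terms.\<close>
  have small: "norm (\<Sum>d = 1..N div K. a d / of_nat d * r (N div d)) \<le> 2 * B / real K"
    if K: "K \<ge> 1" and N: "N \<ge> 1" for N K
  proof -
    have "norm (\<Sum>d = 1..N div K. a d / of_nat d * r (N div d)) \<le> (\<Sum>d = 1..N div K. 2 * B / real N)"
    proof (rule sum_norm_le)
      fix d assume "d \<in> {1..N div K}"
      then have d: "d \<ge> 1" by simp
      have "N < d * Suc (N div d)" using d by (simp add: dividend_less_times_div)
      then have "real N \<le> real d * real (Suc (N div d))"
        by (metis less_imp_le of_nat_le_iff of_nat_mult)
      then have "2 * B / real (Suc (N div d)) \<le> 2 * B * real d / real N"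
      proof -
        have "2 * B * real N \<le> 2 * B * (real d * real (Suc (N div d)))"
          using \<open>real N \<le> _\<close> B0 by (intro mult_left_mono) auto
        then show ?thesis using N by (simp add: divide_le_eq le_divide_eq mult_ac del: of_nat_Suc)
      qed
      then have "norm (r (N div d)) \<le> 2 * B * real d / real N"
        using L[of "N div d"] by (simp add: r_def)
      then have "norm (a d) / real d * norm (r (N div d)) \<le> 1 / real d * (2 * B * real d / real N)"
        using a[of d] d by (intro mult_mono divide_right_mono) auto
      then show "norm (a d / of_nat d * r (N div d)) \<le> 2 * B / real N"
        using d by (simp add: norm_mult norm_divide)
    qed
    also have "\<dots> = real (N div K) * (2 * B / real N)" by simp
    also have "\<dots> \<le> (real N / real K) * (2 * B / real N)"
    proof (rule mult_right_mono)
      have "real (N div K * K) \<le> real N" by (simp only: of_nat_le_iff div_times_less_eq_dividend)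
      then show "real (N div K) \<le> real N / real K" using K by (simp add: le_divide_eq)
    qed (use B0 in simp)
    also have "\<dots> = 2 * B / real K" using N by simp
    finally show ?thesis .
  qed
  \<comment> \<open>The inner sums are replaced by their limit \<open>L\<close> plus the error
    \<open>r\<close>; the limit contributes \<open>L * A N\<close>.\<close>
  have decomp: "(\<Sum>m = 1..N. (\<Sum>d | d dvd m. a d * b (m div d)) / of_nat m)
     = L * A N + (\<Sum>d = 1..N div K. a d / of_nat d * r (N div d))
       + (\<Sum>j = 1..<K. r j * (A (N div j) - A (N div Suc j)))" if K: "K \<ge> 1" for N K
  proof -
    have "{1..N} = {1..N div K} \<union> {N div K<..N}"
      by (auto intro: order_trans[OF _ div_le_dividend])
    then have "(\<Sum>d = 1..N. a d / of_nat d * r (N div d))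
        = (\<Sum>d = 1..N div K. a d / of_nat d * r (N div d)) + (\<Sum>d\<in>{N div K<..N}. a d / of_nat d * r (N div d))"
      by (simp only:) (rule sum.union_disjoint, auto)
    moreover have "(\<Sum>d = 1..N. a d / of_nat d * (\<Sum>t = 1..N div d. b t / of_nat t))
        = L * A N + (\<Sum>d = 1..N. a d / of_nat d * r (N div d))"
      by (simp add: A_def r_def sum_distrib_left sum.distrib[symmetric] algebra_simps)
    ultimately show ?thesis unfolding sum_divisors_eq_sum_hyperbola large[OF K] by simp
  qed
  show ?thesis
  proof (rule LIMSEQ_I)
    fix e :: real assume e: "e > 0"
    \<comment> \<open>\<open>K\<close> is chosen before \<open>N\<close>: for fixed \<open>K\<close>
      only finitely many values \<open>A (N div j)\<close> occur, and all of them tend to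
      \<open>0\<close>.\<close>
    obtain K :: nat where K: "K \<ge> 1" "2 * B / real K < e / 2"
    proof -
      obtain K :: nat where "K > 4 * B / e" using reals_Archimedean2 by blast
      then have "2 * B / real (Suc K) < e / 2"
        using e B0 by (simp add: field_simps)
      then show ?thesis using that[of "Suc K"] by simp
    qed
    have "(\<lambda>N. L * A N + (\<Sum>j = 1..<K. r j * (A (N div j) - A (N div Suc j))))
        \<longlonglongrightarrow> L * 0 + (\<Sum>j = 1..<K. r j * (0 - 0))"
      by (intro tendsto_intros Alim filterlim_compose[OF Alim filterlim_div_sequentially]) auto
    then have "(\<lambda>N. L * A N + (\<Sum>j = 1..<K. r j * (A (N div j) - A (N div Suc j)))) \<longlonglongrightarrow> 0"
      by simp
    from LIMSEQ_D[OF this, of "e / 2"] e obtain M where M: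
      "\<And>N. N \<ge> M \<Longrightarrow> norm (L * A N + (\<Sum>j = 1..<K. r j * (A (N div j) - A (N div Suc j)))) < e / 2"
      by auto
    have "norm ((\<Sum>m = 1..N. (\<Sum>d | d dvd m. a d * b (m div d)) / of_nat m) - 0) < e" if N: "N \<ge> max M 1" for N
    proof -
      define X where "X = L * A N + (\<Sum>j = 1..<K. r j * (A (N div j) - A (N div Suc j)))"
      define Y where "Y = (\<Sum>d = 1..N div K. a d / of_nat d * r (N div d))"
      have "(\<Sum>m = 1..N. (\<Sum>d | d dvd m. a d * b (m div d)) / of_nat m) - 0 = X + Y"
        unfolding decomp[OF K(1)] by (simp add: X_def Y_def)
      moreover have "norm X < e / 2" using M[of N] N by (simp add: X_def)
      moreover have "norm Y \<le> 2 * B / real K" using small[OF K(1), of N] N by (simp add: Y_def)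
      ultimately show ?thesis using norm_triangle_ineq[of X Y] K(2) by simp
    qed
    then show "\<exists>M. \<forall>N\<ge>M. norm ((\<Sum>m = 1..N. (\<Sum>d | d dvd m. a d * b (m div d)) / of_nat m) - 0) < e"
      by blast
  qed
qed

section \<open>Periodic functions and Ramanujan sums\<close>

lemma periodic_add_mult:
  fixes f :: "nat \<Rightarrow> complex"
  assumes "\<And>a. a \<ge> 1 \<Longrightarrow> f (a + T) = f a" and "a \<ge> 1"
  shows "f (a + k * T) = f a"
proof (induction k)
  case (Suc k)
  have "f (a + k * T + T) = f (a + k * T)" using assms by simp
  then show ?case using Suc by (simp add: add_ac)
qed simp

lemma sum_period_shift:
  fixes f :: "nat \<Rightarrow> complex"
  assumes "\<And>a. a \<ge> 1 \<Longrightarrow> f (a + T) = f a"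
  shows "(\<Sum>a = 1..T. f (a + n)) = (\<Sum>a = 1..T. f a)"
proof (induction n)
  case (Suc n)
  have "(\<Sum>a = 1..T. f (a + Suc n)) = (\<Sum>a = Suc 1..Suc T. f (a + n))"
    by (subst sum.shift_bounds_cl_Suc_ivl) simp
  also have "\<dots> = (\<Sum>a = 1..T. f (a + n))"
  proof (cases "T = 0")
    case False
    have "(\<Sum>a = 1..Suc T. f (a + n)) = f (1 + n) + (\<Sum>a = Suc 1..Suc T. f (a + n))"
      by (rule sum.atLeast_Suc_atMost) simp
    moreover have "(\<Sum>a = 1..Suc T. f (a + n)) = (\<Sum>a = 1..T. f (a + n)) + f (Suc T + n)"
      by simp
    moreover have "f (Suc T + n) = f (1 + n)" using assms[of "1 + n"] by (simp add: add_ac)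
    ultimately show ?thesis by simp
  qed (simp)
  finally show ?case using Suc by simp
qed simp

lemma sum_add_split:
  fixes f :: "nat \<Rightarrow> complex"
  shows "(\<Sum>a = 1..m + n. f a) = (\<Sum>a = 1..m. f a) + (\<Sum>a = 1..n. f (a + m))"
proof -
  have "{1..m + n} = {1..m} \<union> {m + 1..m + n}" by auto
  then have "(\<Sum>a = 1..m + n. f a) = (\<Sum>a = 1..m. f a) + (\<Sum>a = 1 + m..n + m. f a)"
    by (simp add: sum.union_disjoint add.commute)
  then show ?thesis by (simp only: sum.shift_bounds_cl_nat_ivl)
qed

text \<open>The partial sums are themselves periodic, so they take finitely many values.\<close>

lemma periodic_zero_mean_sums_bounded:
  fixes f :: "nat \<Rightarrow> complex"
  assumes per: "\<And>a. a \<ge> 1 \<Longrightarrow> f (a + T) = f a" and T: "T \<ge> 1" and zero: "(\<Sum>a = 1..T. f a) = 0"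
  shows "\<exists>B. \<forall>N. norm (\<Sum>a = 1..N. f a) \<le> B"
proof -
  define P where "P N = (\<Sum>a = 1..N. f a)" for N
  have "P (m + k * T) = P m" for m k
  proof (induction k)
    case (Suc k)
    have "P (m + k * T + T) = P (m + k * T) + (\<Sum>a = 1..T. f (a + (m + k * T)))"
      unfolding P_def by (rule sum_add_split)
    also have "(\<Sum>a = 1..T. f (a + (m + k * T))) = 0"
      using sum_period_shift[of f T, OF per] zero by simp
    finally show ?case using Suc by (simp add: add_ac)
  qed simp
  then have eq: "P N = P (N mod T)" for N by (metis mod_div_mult_eq)
  have "norm (P N) \<le> Max ((\<lambda>n. norm (P n)) ` {..<T})" for N
  proof -
    have "N mod T < T" using T by simp
    then have "norm (P (N mod T)) \<le> Max ((\<lambda>n. norm (P n)) ` {..<T})" by (intro Max_ge) auto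
    then show ?thesis using eq[of N] by simp
  qed
  then show ?thesis unfolding P_def by blast
qed

text \<open>After subtracting the mean \<open>m\<close> the partial sums are bounded; replacing
  \<open>x\<close> by its floor costs at most one further \<open>norm m\<close>.\<close>

lemma periodic_mean:
  fixes f :: "nat \<Rightarrow> complex"
  assumes per: "\<And>a. a \<ge> 1 \<Longrightarrow> f (a + T) = f a" and T: "T \<ge> 1"
  shows "((\<lambda>x. 1 / of_real x * (\<Sum>a = 1..nat \<lfloor>x\<rfloor>. f a)) \<longlongrightarrow> (\<Sum>a = 1..T. f a) / of_nat T) at_top"
proof -
  define m where "m = (\<Sum>a = 1..T. f a) / of_nat T"
  have "\<exists>B. \<forall>N. norm (\<Sum>a = 1..N. f a - m) \<le> B"
    by (rule periodic_zero_mean_sums_bounded[of _ T]) (use T per in \<open>auto simp: sum_subtractf m_def\<close>)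
  then obtain B where B: "\<And>N. norm (\<Sum>a = 1..N. f a - m) \<le> B" by blast
  have "((\<lambda>x. 1 / of_real x * (\<Sum>a = 1..nat \<lfloor>x\<rfloor>. f a) - m) \<longlongrightarrow> 0) at_top"
  proof (rule Lim_null_comparison[where g = "\<lambda>x. (B + norm m) / x"])
    show "((\<lambda>x. (B + norm m) / x) \<longlongrightarrow> 0) at_top"
      by (intro tendsto_divide_0[OF tendsto_const] filterlim_at_top_imp_at_infinity filterlim_ident)
    show "\<forall>\<^sub>F x in at_top. norm (1 / of_real x * (\<Sum>a = 1..nat \<lfloor>x\<rfloor>. f a) - m) \<le> (B + norm m) / x"
      using eventually_gt_at_top[of "0::real"]
    proof eventually_elim
      case (elim x)
      define N where "N = nat \<lfloor>x\<rfloor>"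
      have "real N = of_int \<lfloor>x\<rfloor>" using elim by (simp add: N_def)
      then have N: "\<bar>real N - x\<bar> \<le> 1" by linarith
      have "(\<Sum>a = 1..N. f a) = (\<Sum>a = 1..N. f a - m) + of_nat N * m"
        by (simp add: sum_subtractf)
      then have "1 / of_real x * (\<Sum>a = 1..N. f a) - m
          = ((\<Sum>a = 1..N. f a - m) + of_real (real N - x) * m) / of_real x"
        using elim by (simp add: field_simps)
      also have "norm \<dots> \<le> (B + norm m) / x"
      proof -
        have "norm ((\<Sum>a = 1..N. f a - m) + of_real (real N - x) * m) \<le> B + \<bar>real N - x\<bar> * norm m"
          using norm_triangle_le B[of N] by (smt (verit) norm_mult norm_of_real norm_triangle_ineq)
        also have "\<dots> \<le> B + 1 * norm m" using N by (intro add_left_mono mult_right_mono) auto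
        finally show ?thesis using elim by (simp add: norm_divide divide_right_mono)
      qed
      finally show ?case by (simp add: N_def)
    qed
  qed
  then show ?thesis unfolding m_def by (simp add: Lim_null[symmetric])
qed

section \<open>Roots of unity and Ramanujan sums\<close>

definition unity_root :: "nat \<Rightarrow> nat \<Rightarrow> complex" where
  "unity_root q k = exp (2 * of_real pi * \<i> * of_nat k / of_nat q)"

lemma ramanujan_sum_eq: "ramanujan_sum q m = (\<Sum>j | j \<in> {1..q} \<and> coprime j q. unity_root q (j * m))"
  unfolding ramanujan_sum_def unity_root_def by (simp add: mult.assoc)

lemma unity_root_add: "unity_root q (a + b) = unity_root q a * unity_root q b"
  by (simp add: unity_root_def exp_add[symmetric] add_divide_distrib distrib_left)

lemma unity_root_mult: "unity_root q (a * k) = unity_root q a ^ k"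
  by (simp add: unity_root_def exp_of_nat_mult[symmetric] mult_ac)

lemma unity_root_eq_1_iff:
  assumes "q \<ge> 1"
  shows "unity_root q k = 1 \<longleftrightarrow> q dvd k"
proof -
  have "unity_root q k = 1 \<longleftrightarrow> (\<exists>n::int. real k / real q = of_int n)"
  proof -
    have "2 * of_real pi * \<i> * of_nat k / of_nat q = \<i> * of_real (2 * pi * (real k / real q))"
      by simp
    moreover have "2 * pi * (real k / real q) = of_int (2 * n) * pi \<longleftrightarrow> real k / real q = of_int n" for n :: int
    proof -
      have "2 * pi * (real k / real q) = of_int (2 * n) * pi \<longleftrightarrow> (2 * pi) * (real k / real q) = (2 * pi) * of_int n"
        by (simp only: of_int_mult of_int_numeral mult_ac)
      also have "\<dots> \<longleftrightarrow> real k / real q = of_int n" by (rule mult_cancel_left[THEN trans]) simp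
      finally show ?thesis .
    qed
    ultimately show ?thesis
      unfolding unity_root_def exp_eq_1 by (simp add: mult_ac)
  qed
  also have "\<dots> \<longleftrightarrow> (\<exists>n::int. int k = int q * n)"
  proof -
    have "real k / real q = of_int n \<longleftrightarrow> int k = int q * n" for n :: int
    proof -
      have "real k / real q = of_int n \<longleftrightarrow> real k = real q * of_int n"
        using assms by (simp add: field_simps)
      also have "\<dots> \<longleftrightarrow> real_of_int (int k) = real_of_int (int q * n)" by simp
      finally show ?thesis by (simp only: of_int_eq_iff)
    qed
    then show ?thesis by simp
  qed
  also have "\<dots> \<longleftrightarrow> q dvd k" by (metis dvd_def int_dvd_int_iff)
  finally show ?thesis .
qed

lemma sum_unity_root:
  assumes "w ^ M = 1"
  shows "(\<Sum>k = 1..M. w ^ k) = (if w = 1 then of_nat M else (0 :: complex))"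
proof (cases "w = 1")
  case False
  have "(\<Sum>k = 1..M. w ^ k) = w * (\<Sum>k<M. w ^ k)"
    unfolding sum_distrib_left by (rule sum.reindex_bij_witness[where i = Suc and j = "\<lambda>k. k - 1"]) (auto simp flip: power_Suc)
  then show ?thesis using False assms by (simp add: geometric_sum)
qed simp

text \<open>Reducing the fractions \<open>j / q\<close> sorts all \<open>q\<close>-th roots of unity
  by their exact order \<open>d\<close>, so the left side is a complete geometric sum.\<close>

lemma sum_ramanujan_sum_divisors:
  assumes q: "q \<ge> 1"
  shows "(\<Sum>d | d dvd q. ramanujan_sum d m) = (if q dvd m then of_nat q else 0)"
proof -
  have fin: "finite {d. d dvd q}" using q by simp
  have "(\<Sum>d | d dvd q. ramanujan_sum d m)
      = (\<Sum>(d, j)\<in>Sigma {d. d dvd q} (\<lambda>d. {j. j \<in> {1..d} \<and> coprime j d}). unity_root d (j * m))"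
    unfolding ramanujan_sum_eq by (rule sum.Sigma) (use fin in auto)
  also have "\<dots> = (\<Sum>j = 1..q. unity_root q (j * m))"
  proof (rule sum.reindex_bij_witness[where i = "\<lambda>j. (q div gcd j q, j div gcd j q)" and j = "\<lambda>(d, j). j * (q div d)"])
    fix p assume p: "p \<in> Sigma {d. d dvd q} (\<lambda>d. {j. j \<in> {1..d} \<and> coprime j d})"
    then obtain d j where dj: "p = (d, j)" "d dvd q" "1 \<le> j" "j \<le> d" "coprime j d" by auto
    then obtain k where k: "q = d * k" by auto
    have k0: "k \<ge> 1" "d \<ge> 1" using k q by (auto simp: Suc_le_eq)
    have g: "gcd (j * k) (d * k) = k"
      using dj gcd_mult_distrib_nat[of k j d] by (simp add: mult.commute)
    have qd: "q div d = k" using k k0 by simp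
    show "(q div gcd ((\<lambda>(d, j). j * (q div d)) p) q, (\<lambda>(d, j). j * (q div d)) p div gcd ((\<lambda>(d, j). j * (q div d)) p) q) = p"
      using k0 by (simp add: dj(1) qd) (simp add: k g)
    show "(\<lambda>(d, j). j * (q div d)) p \<in> {1..q}"
      using dj k0 by (simp add: qd) (simp add: k)
    have "of_nat (j * k * m) / of_nat (d * k) = (of_nat (j * m) / of_nat d :: complex)"
      using k0 by simp
    then have "unity_root q (j * k * m) = unity_root d (j * m)"
      unfolding unity_root_def k times_divide_eq_right[symmetric] by simp
    then show "unity_root q ((\<lambda>(d, j). j * (q div d)) p * m) = (\<lambda>(d, j). unity_root d (j * m)) p"
      by (simp add: dj(1) qd)
  next
    fix j assume j: "j \<in> {1..q}"
    define g where "g = gcd j q"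
    have g0: "g > 0" using j by (simp add: g_def)
    obtain a b where ab: "j = g * a" "q = g * b" unfolding g_def by (metis dvd_def gcd_dvd1 gcd_dvd2)
    have ab0: "a > 0" "b > 0" using ab j by auto
    have "gcd (g * a) (g * b) = g" by (simp only: ab[symmetric] g_def[symmetric])
    then have "g * gcd a b = g * 1" by (simp only: gcd_mult_distrib_nat mult_1_right)
    then have "gcd a b = 1" using g0 by simp
    then have "coprime a b" by (simp only: coprime_iff_gcd_eq_1)
    then show "(q div gcd j q, j div gcd j q) \<in> Sigma {d. d dvd q} (\<lambda>d. {j. j \<in> {1..d} \<and> coprime j d})"
      unfolding g_def[symmetric] using ab ab0 g0 j by auto
    show "(\<lambda>(d, j). j * (q div d)) (q div gcd j q, j div gcd j q) = j"
      unfolding g_def[symmetric] using ab ab0 g0 by simp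
  qed
  also have "\<dots> = (\<Sum>j = 1..q. unity_root q m ^ j)"
    by (simp add: unity_root_mult[symmetric] mult.commute)
  also have "\<dots> = (if unity_root q m = 1 then of_nat q else 0)"
  proof (rule sum_unity_root)
    show "unity_root q m ^ q = 1"
      unfolding unity_root_mult[symmetric] using unity_root_eq_1_iff[OF q] by simp
  qed
  finally show ?thesis by (simp add: unity_root_eq_1_iff[OF q])
qed

text \<open>Strong induction on the preceding identity: its right side depends only on whether
  \<open>q\<close> divides the argument, and the proper divisors of \<open>q\<close> are covered by
  the hypothesis because \<open>gcd m d\<close> is determined by \<open>gcd m q\<close>.\<close>

lemma ramanujan_sum_cong_gcd:
  assumes "q \<ge> 1" "gcd m q = gcd n q"
  shows "ramanujan_sum q m = ramanujan_sum q n"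
  using assms
proof (induction q rule: less_induct)
  case (less q)
  have split: "(\<Sum>d | d dvd q. ramanujan_sum d k) = ramanujan_sum q k + (\<Sum>d | d dvd q \<and> d \<noteq> q. ramanujan_sum d k)" for k
  proof -
    have "{d. d dvd q} = insert q {d. d dvd q \<and> d \<noteq> q}" by auto
    moreover have "finite {d. d dvd q \<and> d \<noteq> q}"
      using less.prems(1) by (intro finite_subset[OF _ finite_divisors_nat[of q]]) auto
    ultimately show ?thesis by (simp only: sum.insert) simp
  qed
  have "(\<Sum>d | d dvd q \<and> d \<noteq> q. ramanujan_sum d m) = (\<Sum>d | d dvd q \<and> d \<noteq> q. ramanujan_sum d n)"
  proof (rule sum.cong)
    fix d assume "d \<in> {d. d dvd q \<and> d \<noteq> q}"
    then have d: "d dvd q" "d \<noteq> q" by auto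
    have "d \<le> q" using d(1) less.prems(1) by (intro dvd_imp_le) auto
    then have "d < q" using d(2) by simp
    have "d \<ge> 1" using d(1) less.prems(1) by (cases d) auto
    have gcd_d: "gcd k d = gcd (gcd k q) d" for k
      using d(1) by (simp add: gcd.assoc gcd_nat.absorb2)
    show "ramanujan_sum d m = ramanujan_sum d n"
      by (rule less.IH[OF \<open>d < q\<close> \<open>d \<ge> 1\<close>]) (simp only: gcd_d[of m] gcd_d[of n] less.prems(2))
  qed simp
  moreover have "q dvd k \<longleftrightarrow> gcd k q = q" for k
    by (rule gcd_nat.absorb_iff2)
  then have "q dvd m \<longleftrightarrow> q dvd n" using less.prems(2) by simp
  ultimately show ?case
    using sum_ramanujan_sum_divisors[OF less.prems(1), of m] sum_ramanujan_sum_divisors[OF less.prems(1), of n]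
    unfolding split by (metis add_right_cancel)
qed

lemma ramanujan_sum_periodic:
  assumes "q \<ge> 1" "q dvd T"
  shows "ramanujan_sum q (a + T) = ramanujan_sum q a"
proof (rule ramanujan_sum_cong_gcd)
  obtain k where "T = k * q" using assms(2) by (metis dvd_def mult.commute)
  then show "gcd (a + T) q = gcd a q"
    by (metis gcd.commute gcd_add_mult add.commute)
qed (rule assms)

lemma ramanujan_sum_0: "ramanujan_sum q 0 = of_nat (totient q)"
proof -
  have "{j. j \<in> {1..q} \<and> coprime j q} = totatives q"
    by (auto simp: totatives_def)
  then show ?thesis by (simp add: ramanujan_sum_def totient_def)
qed

text \<open>The mean of \<open>c\<^sub>q\<close> over the residue class \<open>a \<equiv> - n (mod d)\<close>. Writing \<open>b = a + n\<close>, we have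
  \<open>a \<equiv> b + (q - 1) n (mod q)\<close>, which avoids negative arguments.\<close>

lemma sum_ramanujan_sum_residue_class:
  assumes q: "q \<ge> 1" and d: "d \<ge> 1" and T: "q dvd T" "d dvd T"
  shows "(\<Sum>a = 1..T. if d dvd n + a then ramanujan_sum q a else 0)
     = of_nat T * (if q dvd d then ramanujan_sum q n / of_nat d else 0)"
proof -
  define J where "J = {j. j \<in> {1..q} \<and> coprime j q}"
  obtain M where M: "T = d * M" using T by auto
  have inner: "(\<Sum>a = 1..T. if d dvd n + a then unity_root q (j * a) else 0)
      = (if q dvd d then unity_root q (j * ((q - 1) * n)) * of_nat M else 0)" if j: "j \<in> J" for j
  proof -
    define h where "h b = (if d dvd b then unity_root q (j * (b + (q - 1) * n)) else 0)" for b
    have "(\<Sum>a = 1..T. if d dvd n + a then unity_root q (j * a) else 0) = (\<Sum>a = 1..T. h (a + n))"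
    proof (rule sum.cong)
      fix a
      have "a + n + (q - 1) * n = a + q * n" using q by (cases q) auto
      then have "unity_root q (j * (a + n + (q - 1) * n)) = unity_root q (j * a) * unity_root q (q * (n * j))"
        by (simp only: distrib_left unity_root_add mult_ac)
      also have "unity_root q (q * (n * j)) = 1" using unity_root_eq_1_iff[OF q] by simp
      finally show "(if d dvd n + a then unity_root q (j * a) else 0) = h (a + n)"
        by (simp add: h_def add.commute)
    qed simp
    also have "\<dots> = (\<Sum>b = 1..T. h b)"
    proof (rule sum_period_shift)
      fix b :: nat
      have "unity_root q (j * T) = 1" using T q by (simp add: unity_root_eq_1_iff)
      then have "unity_root q (j * (b + T + (q - 1) * n)) = unity_root q (j * (b + (q - 1) * n))"
        by (simp add: distrib_left unity_root_add mult_ac)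
      moreover have "d dvd b + T \<longleftrightarrow> d dvd b" using T by (simp add: dvd_add_left_iff)
      ultimately show "h (b + T) = h b" by (simp only: h_def)
    qed
    also have "\<dots> = (\<Sum>b | b \<in> {1..T} \<and> d dvd b. unity_root q (j * (b + (q - 1) * n)))"
      unfolding h_def by (rule sum.mono_neutral_cong_right) auto
    also have "\<dots> = (\<Sum>k = 1..T div d. unity_root q (j * (d * k + (q - 1) * n)))"
      by (rule sum_multiples[OF d])
    also have "\<dots> = unity_root q (j * ((q - 1) * n)) * (\<Sum>k = 1..M. unity_root q (j * d) ^ k)"
      using d by (simp add: M distrib_left unity_root_add unity_root_mult[symmetric] sum_distrib_left mult_ac)
    also have "(\<Sum>k = 1..M. unity_root q (j * d) ^ k) = (if unity_root q (j * d) = 1 then of_nat M else 0)"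
    proof (rule sum_unity_root)
      have "q dvd j * d * M" using T M by (simp add: mult.assoc)
      then show "unity_root q (j * d) ^ M = 1"
        unfolding unity_root_mult[symmetric] using q by (simp add: unity_root_eq_1_iff)
    qed
    \<comment> \<open>Here \<open>j\<close> is coprime to \<open>q\<close> and can be cancelled, so
      the condition is the same for all \<open>j\<close>.\<close>
    also have "unity_root q (j * d) = 1 \<longleftrightarrow> q dvd d"
      using q j by (simp add: unity_root_eq_1_iff J_def coprime_commute coprime_dvd_mult_right_iff)
    finally show ?thesis by simp
  qed
  have "(\<Sum>a = 1..T. if d dvd n + a then ramanujan_sum q a else 0)
      = (\<Sum>a = 1..T. \<Sum>j\<in>J. if d dvd n + a then unity_root q (j * a) else 0)"
    by (intro sum.cong) (auto simp: ramanujan_sum_eq J_def)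
  also have "\<dots> = (\<Sum>j\<in>J. \<Sum>a = 1..T. if d dvd n + a then unity_root q (j * a) else 0)"
    by (rule sum.swap)
  also have "\<dots> = (if q dvd d then ramanujan_sum q ((q - 1) * n) * of_nat M else 0)"
  proof -
    have "(\<Sum>j\<in>J. \<Sum>a = 1..T. if d dvd n + a then unity_root q (j * a) else 0)
        = (\<Sum>j\<in>J. if q dvd d then unity_root q (j * ((q - 1) * n)) * of_nat M else 0)"
      by (rule sum.cong[OF refl inner])
    then show ?thesis by (simp add: ramanujan_sum_eq J_def sum_distrib_right)
  qed
  \<comment> \<open>The factor \<open>q - 1\<close> plays the role of \<open>- 1\<close>, and a
    factor coprime to \<open>q\<close> does not change the gcd with \<open>q\<close>.\<close>
  also have "ramanujan_sum q ((q - 1) * n) = ramanujan_sum q n"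
  proof (rule ramanujan_sum_cong_gcd[OF q])
    have "coprime (q - 1) q" using q by (cases q) auto
    then show "gcd ((q - 1) * n) q = gcd n q"
      by (intro gcd_mult_left_left_cancel) (simp add: coprime_commute)
  qed
  finally show ?thesis using d by (simp add: M)
qed

section \<open>Wintner coefficients of periodic functions\<close>

lemma wintner_term_sums_iff:
  "wintner_term F q sums s \<longleftrightarrow> (\<lambda>N. \<Sum>m = 1..N. wintner_term F q m) \<longlonglongrightarrow> s"
proof -
  have "(\<Sum>m\<le>N. wintner_term F q m) = (\<Sum>m = 1..N. wintner_term F q m)" for N
    by (rule sum.mono_neutral_right) (auto simp: wintner_term_def)
  then show ?thesis by (simp add: sums_def_le)
qed

text \<open>This decouples the two variables: the condition on \<open>d\<close> sees
  \<open>t\<close> only through \<open>gcd t q\<close>.\<close>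

lemma dvd_mult_iff_div_gcd_dvd:
  fixes q t d :: nat
  assumes "q \<ge> 1"
  shows "q dvd t * d \<longleftrightarrow> q div gcd t q dvd d"
proof -
  define g where "g = gcd t q"
  have g: "g > 0" using assms by (simp add: g_def)
  obtain a b where ab: "t = g * a" "q = g * b" unfolding g_def by (metis dvd_def gcd_dvd1 gcd_dvd2)
  have "gcd (g * a) (g * b) = g" by (simp only: ab[symmetric] g_def[symmetric])
  then have "g * gcd a b = g * 1" by (simp only: gcd_mult_distrib_nat mult_1_right)
  then have "gcd a b = 1" using g by simp
  then have cop: "coprime b a" by (simp only: coprime_iff_gcd_eq_1 gcd.commute)
  have "q dvd t * d \<longleftrightarrow> b dvd a * d"
    using g unfolding ab by (simp add: mult.assoc)
  also have "\<dots> \<longleftrightarrow> b dvd d" using cop by (rule coprime_dvd_mult_right_iff)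
  also have "b = q div g" using g unfolding ab by simp
  finally show ?thesis unfolding g_def .
qed

lemma eratosthenes_alt:
  assumes "m \<ge> 1"
  shows "eratosthenes F m = (\<Sum>d | d dvd m. of_int (moebius d) * F (m div d))"
  unfolding eratosthenes_def
proof (rule sum.reindex_bij_witness[where i = "\<lambda>d. m div d" and j = "\<lambda>t. m div t"])
  fix t assume "t \<in> {t. t dvd m}"
  then obtain k where "m = t * k" by (auto elim: dvdE)
  moreover have "t > 0" "k > 0" using \<open>m = t * k\<close> assms by auto
  ultimately show "m div (m div t) = t" "m div t \<in> {d. d dvd m}"
    "of_int (moebius (m div t)) * F (m div (m div t)) = F t * of_int (moebius (m div t))"
    by auto
next
  fix t assume "t \<in> {d. d dvd m}"
  then obtain k where "m = t * k" by (auto elim: dvdE)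
  moreover have "t > 0" "k > 0" using \<open>m = t * k\<close> assms by auto
  ultimately show "m div (m div t) = t" "m div t \<in> {t. t dvd m}" by auto
qed

text \<open>Sorted by \<open>h = gcd t q\<close>, the transform restricted to multiples of
  \<open>q\<close> is a finite sum of Dirichlet convolutions. In each, one factor is the Moebius
  function on multiples of \<open>q div h\<close>, the other has bounded partial sums, and the
  hyperbola method applies.\<close>

lemma wintner_sums_zero:
  assumes q: "q \<ge> 1"
    and bd: "\<And>h. h dvd q \<Longrightarrow> \<exists>B. \<forall>N. norm (\<Sum>t = 1..N. if gcd t q = h then F t else 0) \<le> B"
  shows "wintner_term F q sums 0"
proof -
  define a where "a h d = (if q div h dvd d then of_int (moebius d) else 0 :: complex)" for h d
  define G where "G h t = (if gcd t q = h then F t else 0)" for h t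
  have fin: "finite {h. h dvd q}" using q by simp
  have wterm: "wintner_term F q m = (\<Sum>h | h dvd q. (\<Sum>d | d dvd m. a h d * G h (m div d)) / of_nat m)" if m: "m \<ge> 1" for m
  proof -
    have inner: "(\<Sum>h | h dvd q. a h d * G h (m div d)) = (if q dvd m then of_int (moebius d) * F (m div d) else 0)"
      if d: "d dvd m" for d
    proof -
      define t where "t = m div d"
      have "(\<Sum>h | h dvd q. a h d * G h t) = (\<Sum>h | h dvd q. if h = gcd t q then a h d * F t else 0)"
        by (intro sum.cong) (auto simp: G_def)
      also have "\<dots> = a (gcd t q) d * F t" using fin by simp
      also have "\<dots> = (if q dvd t * d then of_int (moebius d) * F t else 0)"
        unfolding a_def dvd_mult_iff_div_gcd_dvd[OF q] by simp
      finally show ?thesis using d by (simp add: t_def)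
    qed
    have "(\<Sum>h | h dvd q. (\<Sum>d | d dvd m. a h d * G h (m div d)) / of_nat m)
        = (\<Sum>d | d dvd m. \<Sum>h | h dvd q. a h d * G h (m div d)) / of_nat m"
      unfolding sum_divide_distrib[symmetric] by (subst sum.swap) simp
    also have "\<dots> = (\<Sum>d | d dvd m. if q dvd m then of_int (moebius d) * F (m div d) else 0) / of_nat m"
      using inner by simp
    also have "\<dots> = wintner_term F q m"
      using m by (simp add: wintner_term_def eratosthenes_alt)
    finally show ?thesis by simp
  qed
  have "(\<lambda>N. \<Sum>m = 1..N. (\<Sum>d | d dvd m. a h d * G h (m div d)) / of_nat m) \<longlonglongrightarrow> 0" if h: "h dvd q" for h
  proof -
    obtain B where B: "\<And>N. norm (\<Sum>t = 1..N. G h t) \<le> B" using bd[OF h] by (auto simp: G_def)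
    have "q div h \<ge> 1" using h q by (auto elim!: dvdE simp: Suc_le_eq)
    from sum_moebius_multiples_tendsto_0[OF this] show ?thesis
      by (intro sum_dirichlet_product_tendsto_0[OF _ _ B]) (auto simp: a_def norm_moebius_le simp del: norm_of_int)
  qed
  then have "(\<lambda>N. \<Sum>h | h dvd q. \<Sum>m = 1..N. (\<Sum>d | d dvd m. a h d * G h (m div d)) / of_nat m) \<longlonglongrightarrow> (\<Sum>h | h dvd q. 0)"
    by (intro tendsto_sum) auto
  moreover have "(\<Sum>h | h dvd q. \<Sum>m = 1..N. (\<Sum>d | d dvd m. a h d * G h (m div d)) / of_nat m) = (\<Sum>m = 1..N. wintner_term F q m)" for N
    by (subst sum.swap) (intro sum.cong, auto simp: wterm)
  ultimately show ?thesis unfolding wintner_term_sums_iff by simp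
qed

text \<open>Uniqueness in Moebius inversion, by strong induction on the top divisor; it reads off a
  transform from any divisor-sum representation.\<close>

lemma eratosthenes_eqI:
  assumes "\<And>t. t \<ge> 1 \<Longrightarrow> h t = (\<Sum>d | d dvd t. u d)" and "n \<ge> 1"
  shows "eratosthenes h n = u n"
  using assms(2)
proof (induction n rule: less_induct)
  case (less n)
  have split: "(\<Sum>d | d dvd n. v d) = v n + (\<Sum>d | d dvd n \<and> d \<noteq> n. v d)" for v :: "nat \<Rightarrow> complex"
  proof -
    have "{d. d dvd n} = insert n {d. d dvd n \<and> d \<noteq> n}" by auto
    moreover have "finite {d. d dvd n \<and> d \<noteq> n}"
      using less.prems by (intro finite_subset[OF _ finite_divisors_nat[of n]]) auto
    ultimately show ?thesis by (simp only: sum.insert) simp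
  qed
  have "(\<Sum>d | d dvd n \<and> d \<noteq> n. eratosthenes h d) = (\<Sum>d | d dvd n \<and> d \<noteq> n. u d)"
  proof (rule sum.cong)
    fix d assume d: "d \<in> {d. d dvd n \<and> d \<noteq> n}"
    then have "d \<le> n" using less.prems by (intro dvd_imp_le) auto
    then have "d < n" using d by simp
    moreover have "d \<ge> 1" using d less.prems by (cases d) auto
    ultimately show "eratosthenes h d = u d" by (rule less.IH)
  qed simp
  moreover have "(\<Sum>d | d dvd n. eratosthenes h d) = (\<Sum>d | d dvd n. u d)"
    using eratosthenes_inversion[of n h] assms(1)[of n] less.prems by simp
  ultimately show ?case unfolding split by simp
qed

text \<open>Averaging \<open>F\<close> over the classes \<open>gcd t q = h\<close> splits off a function of \<open>gcd t q\<close>, whose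
  Eratosthenes transform is supported on the divisors of \<open>q\<close>, so that its Wintner series has a
  single term. The remainder contributes nothing to either coefficient.\<close>

lemma wintner_sums_periodic:
  fixes F :: "nat \<Rightarrow> complex"
  assumes per: "\<And>a. a \<ge> 1 \<Longrightarrow> F (a + T) = F a" and T: "T \<ge> 1" and q: "q \<ge> 1" "q dvd T"
  shows "wintner_term F q sums ((\<Sum>a = 1..T. F a * ramanujan_sum q a) / of_nat T / of_nat (totient q))"
proof -
  define cls where "cls h = {t \<in> {1..T}. gcd t q = h}" for h
  define \<beta> where "\<beta> h = (\<Sum>t\<in>cls h. F t) / of_nat (card (cls h))" for h
  \<comment> \<open>Inverting \<open>\<beta>\<close> at \<open>gcd t q\<close> writes
    \<open>F1\<close> as a sum of \<open>\<alpha>\<close> over the common divisors of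
    \<open>t\<close> and \<open>q\<close>.\<close>
  define \<alpha> where "\<alpha> = eratosthenes \<beta>"
  define F1 where "F1 t = \<beta> (gcd t q)" for t
  define F2 where "F2 t = F t - F1 t" for t
  define G where "G h t = (if gcd t q = h then F2 t else 0)" for h t
  have fin: "finite {h. h dvd q}" using q by simp
  have gcd_per: "gcd (t + T) q = gcd t q" for t
  proof -
    obtain k where "T = k * q" using q(2) by (metis dvd_def mult.commute)
    then show ?thesis by (metis gcd.commute gcd_add_mult add.commute)
  qed
  have Gzero: "(\<Sum>t = 1..T. G h t) = 0" if h: "h dvd q" for h
  proof -
    have "h \<le> q" "h \<ge> 1" "q \<le> T" using h q T by (auto simp: dvd_imp_le Suc_le_eq intro!: Nat.gr0I)
    \<comment> \<open>The class contains \<open>h\<close> itself, so its cardinality is nonzero and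
      \<open>\<beta> h\<close> is a genuine average rather than a division by zero.\<close>
    then have "h \<in> cls h" using h by (auto simp: cls_def gcd_nat.absorb1)
    moreover have "finite (cls h)" by (simp add: cls_def)
    ultimately have "card (cls h) \<noteq> 0" by auto
    moreover have "(\<Sum>t = 1..T. G h t) = (\<Sum>t\<in>cls h. F t - \<beta> h)"
      by (rule sum.mono_neutral_cong_right) (auto simp: cls_def G_def F2_def F1_def)
    ultimately show ?thesis by (simp add: sum_subtractf \<beta>_def)
  qed
  have "wintner_term F2 q sums 0"
  proof (rule wintner_sums_zero[OF q(1)])
    fix h assume h: "h dvd q"
    have "\<exists>B. \<forall>N. norm (\<Sum>t = 1..N. G h t) \<le> B"
      by (rule periodic_zero_mean_sums_bounded[OF _ T Gzero[OF h]])
         (simp add: G_def F2_def F1_def gcd_per per)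
    then show "\<exists>B. \<forall>N. norm (\<Sum>t = 1..N. if gcd t q = h then F2 t else 0) \<le> B"
      unfolding G_def .
  qed
  moreover have eF1: "F1 t = (\<Sum>d | d dvd t. if d dvd q then \<alpha> d else 0)" if t: "t \<ge> 1" for t
  proof -
    have "F1 t = (\<Sum>d | d dvd gcd t q. \<alpha> d)"
      unfolding F1_def \<alpha>_def using t by (intro eratosthenes_inversion) simp
    also have "\<dots> = (\<Sum>d | d dvd t. if d dvd q then \<alpha> d else 0)"
      using t by (intro sum.mono_neutral_cong_left) auto
    finally show ?thesis .
  qed
  have "wintner_term F1 q sums (\<alpha> q / of_nat q)"
  proof -
    have "wintner_term F1 q = (\<lambda>d. if d = q then \<alpha> d / of_nat d else 0)"
    proof
      fix d
      show "wintner_term F1 q d = (if d = q then \<alpha> d / of_nat d else 0)"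
      proof (cases "d \<ge> 1")
        case True
        then show ?thesis
          using eratosthenes_eqI[of F1 "\<lambda>d. if d dvd q then \<alpha> d else 0", OF eF1 True] q by (auto simp: wintner_term_def dest: dvd_antisym)
      qed (use q in \<open>auto simp: wintner_term_def\<close>)
    qed
    then show ?thesis using sums_single[of q "\<lambda>d. \<alpha> d / of_nat d"] by simp
  qed
  ultimately have "(\<lambda>d. wintner_term F2 q d + wintner_term F1 q d) sums (0 + \<alpha> q / of_nat q)"
    by (intro sums_add)
  moreover have "wintner_term F2 q d + wintner_term F1 q d = wintner_term F q d" for d
    by (simp add: wintner_term_def eratosthenes_def F2_def sum.distrib[symmetric]
        add_divide_distrib[symmetric] left_diff_distrib)
  ultimately have "wintner_term F q sums (\<alpha> q / of_nat q)" by simp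
  \<comment> \<open>The same splitting on the Carmichael side. \<open>F2\<close> drops out because
    \<open>c_q\<close> is constant on each class; for \<open>F1\<close> the residue class formula
    requires \<open>q dvd d\<close> while \<open>d dvd q\<close>, so only \<open>d = q\<close>
    remains, with the value of \<open>c_q\<close> at \<open>0\<close>.\<close>
  moreover have "(\<Sum>a = 1..T. F a * ramanujan_sum q a) = of_nat T * (\<alpha> q * of_nat (totient q) / of_nat q)"
  proof -
    have "(\<Sum>a = 1..T. F a * ramanujan_sum q a)
        = (\<Sum>a = 1..T. F2 a * ramanujan_sum q a) + (\<Sum>a = 1..T. F1 a * ramanujan_sum q a)"
      by (simp add: F2_def sum.distrib[symmetric] left_diff_distrib)
    also have "(\<Sum>a = 1..T. F2 a * ramanujan_sum q a) = (\<Sum>a = 1..T. \<Sum>h | h dvd q. G h a * ramanujan_sum q h)"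
    proof (rule sum.cong)
      fix a
      have "(\<Sum>h | h dvd q. G h a * ramanujan_sum q h) = (\<Sum>h | h dvd q. if h = gcd a q then F2 a * ramanujan_sum q h else 0)"
        by (intro sum.cong) (auto simp: G_def)
      also have "\<dots> = F2 a * ramanujan_sum q (gcd a q)" using fin by simp
      also have "ramanujan_sum q (gcd a q) = ramanujan_sum q a"
        by (rule ramanujan_sum_cong_gcd[OF q(1)]) (simp add: gcd.assoc)
      finally show "F2 a * ramanujan_sum q a = (\<Sum>h | h dvd q. G h a * ramanujan_sum q h)" by simp
    qed simp
    also have "\<dots> = (\<Sum>h | h dvd q. (\<Sum>a = 1..T. G h a) * ramanujan_sum q h)"
      unfolding sum_distrib_right by (rule sum.swap)
    also have "\<dots> = 0" using Gzero by simp
    also have "(\<Sum>a = 1..T. F1 a * ramanujan_sum q a)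
        = (\<Sum>a = 1..T. \<Sum>d | d dvd q. \<alpha> d * (if d dvd 0 + a then ramanujan_sum q a else 0))"
    proof (rule sum.cong)
      fix a assume "a \<in> {1..T}"
      then have a: "a \<ge> 1" by simp
      have "F1 a = (\<Sum>d | d dvd q. if d dvd a then \<alpha> d else 0)"
        unfolding eF1[OF a] by (rule sum.mono_neutral_cong) (use a fin in auto)
      then show "F1 a * ramanujan_sum q a = (\<Sum>d | d dvd q. \<alpha> d * (if d dvd 0 + a then ramanujan_sum q a else 0))"
        by (simp add: sum_distrib_right if_distrib[of "\<lambda>x. x * _"] if_distrib[of "\<lambda>x. _ * x"] cong: if_cong)
    qed simp
    also have "\<dots> = (\<Sum>d | d dvd q. \<alpha> d * (\<Sum>a = 1..T. if d dvd 0 + a then ramanujan_sum q a else 0))"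
      unfolding sum_distrib_left by (rule sum.swap)
    also have "\<dots> = (\<Sum>d | d dvd q. if d = q then of_nat T * (\<alpha> d * of_nat (totient q) / of_nat d) else 0)"
    proof (rule sum.cong)
      fix d assume "d \<in> {d. d dvd q}"
      then have d: "d dvd q" by simp
      then have "d \<ge> 1" "d dvd T" using q by (auto simp: Suc_le_eq intro!: Nat.gr0I)
      from sum_ramanujan_sum_residue_class[OF q(1) this(1) q(2) this(2), of 0]
      show "\<alpha> d * (\<Sum>a = 1..T. if d dvd 0 + a then ramanujan_sum q a else 0)
          = (if d = q then of_nat T * (\<alpha> d * of_nat (totient q) / of_nat d) else 0)"
        using d by (auto simp: ramanujan_sum_0 dest: dvd_antisym)
    qed simp
    also have "\<dots> = of_nat T * (\<alpha> q * of_nat (totient q) / of_nat q)" using fin by simp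
    finally show ?thesis by simp
  qed
  ultimately show ?thesis using T q by simp
qed

lemma periodic_image_subset:
  fixes f :: "nat \<Rightarrow> complex"
  assumes per: "\<And>a. a \<ge> 1 \<Longrightarrow> f (a + T) = f a" and T: "T \<ge> 1"
  shows "f ` {1..} \<subseteq> f ` {1..T}"
proof
  fix y assume "y \<in> f ` {1..}"
  then obtain a where a: "a \<ge> 1" "y = f a" by auto
  define b where "b = (a - 1) mod T + 1"
  have "a = b + (a - 1) div T * T" using a by (simp add: b_def)
  then have "f a = f b" using periodic_add_mult[of f T, OF per, of b] by (metis b_def le_add2)
  moreover have "b \<in> {1..T}" using T by (auto simp: b_def Suc_le_eq)
  ultimately show "y \<in> f ` {1..T}" using a by auto
qed

section \<open>The correlation as a function of the shift\<close>

text \<open>Moebius inversion at \<open>n + a\<close>, where the hypothesis cuts off the divisors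
  beyond \<open>Q\<close>. The shift now enters only through divisibility by finitely many
  \<open>d\<close>, which is the source of periodicity.\<close>

lemma correlation_truncated:
  assumes "\<forall>d>Q. eratosthenes g d = 0" and a: "a \<ge> 1"
  shows "correlation f g N a = (\<Sum>n = 1..N. f n * (\<Sum>d = 1..Q. if d dvd n + a then eratosthenes g d else 0))"
proof -
  have "g m = (\<Sum>d = 1..Q. if d dvd m then eratosthenes g d else 0)" if m: "m \<ge> 1" for m
  proof -
    have "g m = (\<Sum>d | d dvd m. eratosthenes g d)" using m by (intro eratosthenes_inversion) simp
    also have "\<dots> = (\<Sum>d | d dvd m \<and> d \<le> Q. eratosthenes g d)"
      using m assms(1) by (intro sum.mono_neutral_right) (auto simp: not_le)
    also have "\<dots> = (\<Sum>d = 1..Q. if d dvd m then eratosthenes g d else 0)"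
      using m by (intro sum.mono_neutral_cong_left) (auto simp: Suc_le_eq intro!: Nat.gr0I)
    finally show ?thesis .
  qed
  then show ?thesis using a by (simp add: correlation_def)
qed

lemma correlation_periodic:
  assumes "\<forall>d>Q. eratosthenes g d = 0" and "a \<ge> 1" and T: "\<And>d. 1 \<le> d \<Longrightarrow> d \<le> Q \<Longrightarrow> d dvd T"
  shows "correlation f g N (a + T) = correlation f g N a"
proof -
  have "d dvd n + (a + T) \<longleftrightarrow> d dvd n + a" if "d \<in> {1..Q}" for d n
    using T[of d] that by (simp add: add.assoc[symmetric] dvd_add_left_iff)
  then have "(\<Sum>d = 1..Q. if d dvd n + (a + T) then eratosthenes g d else 0)
      = (\<Sum>d = 1..Q. if d dvd n + a then eratosthenes g d else 0)" for n
    by (intro sum.cong) auto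
  then show ?thesis
    using assms(1,2) by (simp only: correlation_truncated trans_le_add1)
qed

text \<open>For fixed \<open>n\<close> and \<open>d\<close> the sum over \<open>a\<close> runs
  through one residue class modulo \<open>d\<close> and yields \<open>c_l(n) / d\<close> if
  \<open>l dvd d\<close>, and \<open>0\<close> otherwise. The weights
  \<open>eratosthenes g d / d\<close> over multiples of \<open>l\<close> then assemble to
  \<open>g_hat\<close>, independently of \<open>n\<close>.\<close>

lemma sum_correlation_ramanujan:
  assumes g: "\<forall>d>Q. eratosthenes g d = 0" and l: "l \<ge> 1" "l dvd T"
    and T: "\<And>d. 1 \<le> d \<Longrightarrow> d \<le> Q \<Longrightarrow> d dvd T"
  shows "(\<Sum>a = 1..T. correlation f g N a * ramanujan_sum l a)
     = of_nat T * (g_hat g Q l * (\<Sum>n = 1..N. f n * ramanujan_sum l n))"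
proof -
  have "(\<Sum>a = 1..T. correlation f g N a * ramanujan_sum l a)
      = (\<Sum>a = 1..T. \<Sum>n = 1..N. \<Sum>d = 1..Q. f n * eratosthenes g d * (if d dvd n + a then ramanujan_sum l a else 0))"
    by (intro sum.cong refl)
       (auto simp: correlation_truncated[OF g] sum_distrib_left sum_distrib_right intro!: sum.cong)
  also have "\<dots> = (\<Sum>n = 1..N. \<Sum>d = 1..Q. f n * eratosthenes g d * (\<Sum>a = 1..T. if d dvd n + a then ramanujan_sum l a else 0))"
    unfolding sum_distrib_left by (rule trans[OF sum.swap]) (intro sum.cong refl sum.swap)
  also have "\<dots> = (\<Sum>n = 1..N. \<Sum>d = 1..Q. of_nat T * (f n * ramanujan_sum l n * (if l dvd d then eratosthenes g d / of_nat d else 0)))"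
  proof (intro sum.cong refl)
    fix n d assume "d \<in> {1..Q}"
    then have "d \<ge> 1" "d dvd T" using T by auto
    then show "f n * eratosthenes g d * (\<Sum>a = 1..T. if d dvd n + a then ramanujan_sum l a else 0)
       = of_nat T * (f n * ramanujan_sum l n * (if l dvd d then eratosthenes g d / of_nat d else 0))"
      unfolding sum_ramanujan_sum_residue_class[OF l(1) \<open>d \<ge> 1\<close> l(2) \<open>d dvd T\<close>] by simp
  qed
  also have "\<dots> = of_nat T * ((\<Sum>n = 1..N. f n * ramanujan_sum l n) * (\<Sum>d = 1..Q. if l dvd d then eratosthenes g d / of_nat d else 0))"
    by (subst sum_product) (simp only: sum_distrib_left)
  also have "(\<Sum>d = 1..Q. if l dvd d then eratosthenes g d / of_nat d else 0) = g_hat g Q l"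
    unfolding g_hat_def by (rule sum.mono_neutral_cong_right) auto
  finally show ?thesis by (simp add: mult.commute)
qed

theorem theorem3p1:
  fixes N Q :: nat and f g :: "nat \<Rightarrow> complex"
  assumes "1 \<le> Q" and "Q \<le> N"
    and "\<forall>d>Q. eratosthenes g d = 0"
  shows "((\<exists>T\<ge>1. \<forall>a\<ge>1. correlation f g N (a + T) = correlation f g N a)
           \<and> bounded (correlation f g N ` {1..}))
       \<and> (\<forall>l\<ge>1. carmichael_exists (correlation f g N) l
           \<and> wintner_exists (correlation f g N) l
           \<and> carmichael (correlation f g N) l = wintner (correlation f g N) l
           \<and> (l > Q \<longrightarrow> carmichael (correlation f g N) l = 0
                     \<and> wintner (correlation f g N) l = 0))
       \<and> (\<forall>l\<ge>1.
             wintner (correlation f g N) l = carmichael (correlation f g N) l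
           \<and> carmichael (correlation f g N) l
               = g_hat g Q l / of_nat (totient l) * (\<Sum>n = 1..N. f n * ramanujan_sum l n))"
proof -
  let ?C = "correlation f g N"
  \<comment> \<open>\<open>fact Q\<close> serves as a common multiple of
    \<open>1..Q\<close>.\<close>
  have fact_dvd: "d dvd fact Q" if "1 \<le> d" "d \<le> Q" for d
    using that by (simp add: dvd_fact)
  have per: "?C (a + fact Q) = ?C a" if "a \<ge> 1" for a
    using correlation_periodic[OF assms(3) that fact_dvd] by simp
  have A: "(\<exists>T\<ge>1. \<forall>a\<ge>1. ?C (a + T) = ?C a) \<and> bounded (?C ` {1..})"
  proof
    show "\<exists>T\<ge>1. \<forall>a\<ge>1. ?C (a + T) = ?C a"
      using per by (intro exI[of _ "fact Q"]) (auto simp: fact_ge_1)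
    show "bounded (?C ` {1..})"
      by (rule bounded_subset[OF finite_imp_bounded periodic_image_subset[of ?C "fact Q", OF per]]) (auto simp: fact_ge_1)
  qed
  have B: "carmichael_exists ?C l \<and> wintner_exists ?C l \<and> carmichael ?C l = wintner ?C l
      \<and> carmichael ?C l = g_hat g Q l / of_nat (totient l) * (\<Sum>n = 1..N. f n * ramanujan_sum l n)"
    if l: "l \<ge> 1" for l
  proof -
    \<comment> \<open>The factor \<open>l\<close> makes \<open>T\<close> a period of
      \<open>c_l\<close> as well, so that both coefficients reduce to the same finite mean over
      \<open>T\<close>.\<close>
    define T where "T = l * fact Q"
    have T: "T \<ge> 1" using l by (simp add: T_def Suc_le_eq)
    have lT: "l dvd T" by (simp add: T_def)
    have dT: "d dvd T" if "1 \<le> d" "d \<le> Q" for d using fact_dvd[OF that] by (simp add: T_def)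
    have perT: "?C (a + T) = ?C a" if "a \<ge> 1" for a
      using correlation_periodic[OF assms(3) that dT] by simp
    define S where "S = g_hat g Q l * (\<Sum>n = 1..N. f n * ramanujan_sum l n)"
    have mean: "(\<Sum>a = 1..T. ?C a * ramanujan_sum l a) = of_nat T * S"
      unfolding S_def by (rule sum_correlation_ramanujan[OF assms(3) l lT dT])
    have "(carmichael_mean ?C l \<longlongrightarrow> (\<Sum>a = 1..T. ?C a * ramanujan_sum l a) / of_nat T) at_top"
      unfolding carmichael_mean_def[abs_def]
      by (rule periodic_mean[OF _ T]) (simp add: perT ramanujan_sum_periodic[OF l lT])
    then have lim: "(carmichael_mean ?C l \<longlongrightarrow> S) at_top" using mean T by simp
    then have car: "carmichael ?C l = S / of_nat (totient l)"
      unfolding carmichael_def using tendsto_Lim[OF trivial_limit_at_top_linorder lim] by simp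
    have "wintner_term ?C l sums (S / of_nat (totient l))"
      using wintner_sums_periodic[of ?C T l, OF perT T l lT] mean T by simp
    then have "wintner_exists ?C l" "wintner ?C l = S / of_nat (totient l)"
      unfolding wintner_exists_def wintner_def by (auto simp: sums_iff)
    then show ?thesis using car lim by (auto simp: carmichael_exists_def S_def)
  qed
  \<comment> \<open>No positive multiple of \<open>l\<close> lies in \<open>{1..Q}\<close>, so the
    sum is empty.\<close>
  have "g_hat g Q l = 0" if "l > Q" for l
    unfolding g_hat_def using that by (intro sum.neutral) (auto dest: dvd_imp_le)
  then have C: "carmichael ?C l = 0 \<and> wintner ?C l = 0" if "l \<ge> 1" "l > Q" for l
    using B[OF that(1)] that(2) by auto
  show ?thesis
    by (rule conjI[OF A], intro conjI allI impI) (use B C in \<open>metis+\<close>)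
qed

end
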